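(* Let $k_0\ge0$ be a fixed integer. The reduction algorithm (defined in the context), applied to the Vietoris-Rips complex based on a binomial point process of $n$ points on the torus $\mathbb{T}^d_a$ in the supercritical regime $\frac1n=o(\theta)$, has (as $n\to\infty$) a complexity in $$O(n^{k_0+3}2^n).$$
   Context: Setting. $\mathbb{T}^d_a$ is the $d$-dimensional torus of side $a$, with the distance induced by the uniform norm $\|x\|_\infty=\max_i|x_i|$. A binomial point process of $n$ points is a set of $n$ independent uniformly distributed points on $\mathbb{T}^d_a$. The Vietoris-Rips complex on these points is the abstract simplicial complex whose $k$-simplices are the sets of $k+1$ points that are pairwise within the connection distance $r$ of each other. Put $\theta=(r/a)^d$, which may depend on $n$, and assume $\theta\le(1/2)^d$. Simplicial notions. A $k$-simplex has $k+1$ vertices; a coface of a simplex is a simplex containing it. $\beta_k(S)$ is the dimension of $H_k(S)$ (simplicial homology over a field). The degree of a simplex $\sigma$ of $S$ is $D(\sigma)=\max\{d' : \sigma\subset\tau \text{ for some } d'\text{-simplex }\tau\text{ of }S\}$. The index of a $0$-simplex $x$ is $I(x)=\min\{D(\sigma):\sigma \text{ a }(k_0+1)\text{-simplex of }S\text{ containing }x\}$, with $I(x)=0$ if there is none. Reduction algorithm. Input: complex $S$, list $L$ of critical $0$-simplices, integer $k_0$. Compute $\beta_0(S),\dots,\beta_{k_0}(S)$, the degrees of all $(k_0+1)$-simplices, and the indices of all $0$-simplices; then set $I(x)=-1$ for every $x\in L$. Let $I_{\max}$ denote the maximum of the current indices. While $I_{\max}>k_0+1$: draw uniformly at random a $0$-simplex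 $\hat x$ with $I(\hat x)=I_{\max}$; let $S'$ be $S$ with $\hat x$ and all its cofaces removed; compute $\beta_0(S'),\dots,\beta_{k_0}(S')$. If $\beta_k(S')\ne\beta_k(S)$ for some $k\in\{0,\dots,k_0\}$, cancel the removal (keep $S$) and set $I(\hat x)=-1$. Otherwise, replace $S$ by $S'$, recompute the degrees of the $(k_0+1)$-simplices and the indices of all $0$-simplices whose current index is not $-1$. Update $I_{\max}$. When the loop ends, output $S$. Complexity means worst-case number of elementary operations. The complex is given by the list of all its simplices; field operations and inclusion tests between simplices have unit cost; Betti numbers are computed from the ranks of the boundary matrices, and the rank of an $n\times m$ matrix costs $O(nm\min(n,m))$. *)

theory Defs
  imports "HOL-Probability.Probability" "HOL-Library.Function_Algebras"
begin

section \<open>Binomial point process on the torus\<close>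

text \<open>The torus of side \<open>a\<close> is the quotient of \<open>\<real>\<^sup>d\<close> by the lattice \<open>a\<int>\<^sup>d\<close>, represented by the
  half-open cube of side \<open>a\<close>. Its distance is the quotient distance of the uniform norm.\<close>

definition torus :: "real \<Rightarrow> (real ^ 'd) set" where
  "torus a = {x. \<forall>i. 0 \<le> x $ i \<and> x $ i < a}"

definition torus_dist :: "real \<Rightarrow> real ^ 'd \<Rightarrow> real ^ 'd \<Rightarrow> real" where
  "torus_dist a x y = (INF z :: int ^ 'd. infnorm (x - y + a *\<^sub>R (\<chi> i. of_int (z $ i))))"

definition binomial_process ::
  "'w measure \<Rightarrow> real \<Rightarrow> nat \<Rightarrow> (nat \<Rightarrow> 'w \<Rightarrow> real ^ 'd) \<Rightarrow> bool" where
  "binomial_process M a n X \<longleftrightarrow>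
     prob_space M \<and>
     prob_space.indep_vars M (\<lambda>_. borel) X {..<n} \<and>
     (\<forall>i<n. distr M borel (X i) = uniform_measure lborel (torus a))"

text \<open>The vertex \<open>i\<close> stands for the point \<open>P i\<close>. Labels rather than points are used because they
  are linearly ordered, which fixes the orientation of simplices; the points of a binomial process
  are almost surely distinct.\<close>

definition vietoris_rips :: "real \<Rightarrow> real \<Rightarrow> nat \<Rightarrow> (nat \<Rightarrow> real ^ 'd) \<Rightarrow> nat set set" where
  "vietoris_rips a r n P =
     {\<sigma>. \<sigma> \<noteq> {} \<and> \<sigma> \<subseteq> {..<n} \<and> (\<forall>i\<in>\<sigma>. \<forall>j\<in>\<sigma>. i \<noteq> j \<longrightarrow> torus_dist a (P i) (P j) \<le> r)}"


section \<open>Simplicial homology over a field\<close>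

definition abstract_complex :: "'v set set \<Rightarrow> bool" where
  "abstract_complex S \<longleftrightarrow>
     (\<forall>\<sigma>\<in>S. finite \<sigma> \<and> \<sigma> \<noteq> {} \<and> (\<forall>\<tau>. \<tau> \<noteq> {} \<and> \<tau> \<subseteq> \<sigma> \<longrightarrow> \<tau> \<in> S))"

definition simplices :: "nat \<Rightarrow> 'v set set \<Rightarrow> 'v set set" where
  "simplices k S = {\<sigma> \<in> S. card \<sigma> = k + 1}"

interpretation chain: vector_space "\<lambda>(c :: 'f :: field) (f :: 'v set \<Rightarrow> 'f) \<sigma>. c * f \<sigma>"
  by unfold_locales (simp_all add: fun_eq_iff algebra_simps)

definition chain_space :: "nat \<Rightarrow> 'v set set \<Rightarrow> ('v set \<Rightarrow> 'f :: field) set" where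
  "chain_space k S = {c. \<forall>\<sigma>. \<sigma> \<notin> simplices k S \<longrightarrow> c \<sigma> = 0}"

text \<open>The sign of the face of \<open>\<sigma>\<close> opposite to \<open>v\<close> is given by the position of \<open>v\<close> in \<open>\<sigma>\<close>; the
  incidence number is \<open>0\<close> if \<open>\<tau>\<close> is not a facet of \<open>\<sigma>\<close>.\<close>

definition incidence :: "'v :: linorder set \<Rightarrow> 'v set \<Rightarrow> 'f :: field" where
  "incidence \<tau> \<sigma> = (\<Sum>v\<in>\<sigma>. if \<sigma> - {v} = \<tau> then (- 1) ^ card {w \<in> \<sigma>. w < v} else 0)"

text \<open>The empty face is left out, so the boundary of a \<open>0\<close>-chain is \<open>0\<close> (homology is not reduced).\<close>

definition boundary ::
  "nat \<Rightarrow> 'v :: linorder set set \<Rightarrow> ('v set \<Rightarrow> 'f :: field) \<Rightarrow> 'v set \<Rightarrow> 'f" where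
  "boundary k S c = (\<lambda>\<tau>. if \<tau> = {} then 0 else \<Sum>\<sigma>\<in>simplices k S. c \<sigma> * incidence \<tau> \<sigma>)"

definition cycles :: "nat \<Rightarrow> 'v :: linorder set set \<Rightarrow> ('v set \<Rightarrow> 'f :: field) set" where
  "cycles k S = {c \<in> chain_space k S. boundary k S c = 0}"

definition boundaries :: "nat \<Rightarrow> 'v :: linorder set set \<Rightarrow> ('v set \<Rightarrow> 'f :: field) set" where
  "boundaries k S = boundary (k + 1) S ` chain_space (k + 1) S"

text \<open>Dimension of the homology space: the least number of cycles whose classes modulo boundaries
  span the quotient of the cycles by the boundaries.\<close>

definition betti :: "'f :: field itself \<Rightarrow> nat \<Rightarrow> 'v :: linorder set set \<Rightarrow> nat" where
  "betti _ k S = (LEAST m. \<exists>B :: ('v set \<Rightarrow> 'f) set. B \<subseteq> cycles k S \<and> finite B \<and> card B = m \<and>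
      (\<forall>z \<in> cycles k S. \<exists>u \<in> chain.span B. z - u \<in> boundaries k S))"


section \<open>Degrees and indices\<close>

definition simplex_degree :: "'v set set \<Rightarrow> 'v set \<Rightarrow> nat" where
  "simplex_degree S \<sigma> = Max {d. \<exists>\<tau> \<in> simplices d S. \<sigma> \<subseteq> \<tau>}"

definition vertex_index :: "nat \<Rightarrow> 'v set set \<Rightarrow> 'v \<Rightarrow> nat" where
  "vertex_index k\<^sub>0 S x =
     (if \<exists>\<sigma> \<in> simplices (k\<^sub>0 + 1) S. x \<in> \<sigma>
      then Min (simplex_degree S ` {\<sigma> \<in> simplices (k\<^sub>0 + 1) S. x \<in> \<sigma>}) else 0)"


section \<open>Instrumented computations\<close>

text \<open>A computation returns its result together with the number of elementary operations it used.
  One unit each is charged for: an inclusion test, reading the dimension of a simplex, an operation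
  on or comparison of integers, reading or writing a table entry, a field operation, and the
  traversal of one list element.\<close>

type_synonym 'a timed = "'a \<times> nat"

primrec timed_fold :: "('b \<Rightarrow> 'a \<Rightarrow> 'a timed) \<Rightarrow> 'b list \<Rightarrow> 'a \<Rightarrow> 'a timed" where
  "timed_fold f [] a = (a, 1)"
| "timed_fold f (x # xs) a =
     (let (b, t) = f x a; (c, u) = timed_fold f xs b in (c, 1 + t + u))"

primrec timed_map :: "('b \<Rightarrow> 'a timed) \<Rightarrow> 'b list \<Rightarrow> 'a list timed" where
  "timed_map f [] = ([], 1)"
| "timed_map f (x # xs) =
     (let (y, t) = f x; (ys, u) = timed_map f xs in (y # ys, 1 + t + u))"

primrec timed_filter :: "('b \<Rightarrow> bool) \<Rightarrow> 'b list \<Rightarrow> 'b list timed" where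
  "timed_filter P [] = ([], 1)"
| "timed_filter P (x # xs) =
     (let (ys, u) = timed_filter P xs in (if P x then x # ys else ys, 2 + u))"

text \<open>A complex is given by the list of its simplices.\<close>

definition list_vertices :: "'v set list \<Rightarrow> 'v list timed" where
  "list_vertices Ss =
     (let (Vs, t) = timed_filter (\<lambda>\<sigma>. card \<sigma> = 1) Ss;
          (xs, u) = timed_map (\<lambda>\<sigma>. (the_elem \<sigma>, 1)) Vs
      in (xs, t + u))"

text \<open>The boundary matrix is stored column by column, a column being a function on the
  row indices \<open>Rs\<close>. The sign of an entry is found by comparing vertices of \<open>\<sigma>\<close>.\<close>

definition boundary_column ::
  "'v :: linorder set list \<Rightarrow> 'v set \<Rightarrow> ('v set \<Rightarrow> 'f :: field) timed" where
  "boundary_column Rs \<sigma> =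
     timed_fold (\<lambda>\<tau> col. (col(\<tau> := incidence \<tau> \<sigma>), 2 + card \<sigma>)) Rs (\<lambda>_. 0)"

text \<open>\<open>rc p q\<close> is the cost of the rank of a matrix with \<open>p\<close> rows and \<open>q\<close> columns; the value is the
  dimension of the column space. In dimension \<open>0\<close> there are no rows.\<close>

definition boundary_rank ::
  "'f :: field itself \<Rightarrow> (nat \<Rightarrow> nat \<Rightarrow> nat) \<Rightarrow> nat \<Rightarrow> 'v :: linorder set list \<Rightarrow> nat timed" where
  "boundary_rank _ rc k Ss =
     (let (Rs, t1) = timed_filter (\<lambda>\<sigma>. card \<sigma> = k) Ss;
          (Cs, t2) = timed_filter (\<lambda>\<sigma>. card \<sigma> = k + 1) Ss;
          (cols :: ('v set \<Rightarrow> 'f) list, t3) = timed_map (boundary_column Rs) Cs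
      in (chain.dim (set cols), t1 + t2 + t3 + rc (length Rs) (length Cs)))"

definition compute_betti ::
  "'f :: field itself \<Rightarrow> (nat \<Rightarrow> nat \<Rightarrow> nat) \<Rightarrow> 'v :: linorder set list \<Rightarrow> nat \<Rightarrow> nat timed" where
  "compute_betti F rc Ss k =
     (let (Cs, t1) = timed_filter (\<lambda>\<sigma>. card \<sigma> = k + 1) Ss;
          (s, t2) = timed_fold (\<lambda>_ m. (m + 1, 1)) Cs 0;
          (\<rho>, t3) = boundary_rank F rc k Ss;
          (\<rho>', t4) = boundary_rank F rc (k + 1) Ss
      in (s - \<rho> - \<rho>', t1 + t2 + t3 + t4 + 2))"

definition compute_bettis ::
  "'f :: field itself \<Rightarrow> (nat \<Rightarrow> nat \<Rightarrow> nat) \<Rightarrow> nat \<Rightarrow> 'v :: linorder set list \<Rightarrow> nat list timed" where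
  "compute_bettis F rc k\<^sub>0 Ss = timed_map (compute_betti F rc Ss) [0..<k\<^sub>0 + 1]"

definition compute_degree :: "'v set list \<Rightarrow> 'v set \<Rightarrow> nat timed" where
  "compute_degree Ss \<sigma> =
     timed_fold (\<lambda>\<tau> d. if \<sigma> \<subseteq> \<tau> then (max d (card \<tau> - 1), 3) else (d, 1)) Ss 0"

definition compute_degrees :: "nat \<Rightarrow> 'v set list \<Rightarrow> ('v set \<times> nat) list timed" where
  "compute_degrees k\<^sub>0 Ss =
     (let (\<Sigma>s, t) = timed_filter (\<lambda>\<sigma>. card \<sigma> = k\<^sub>0 + 2) Ss;
          (ds, u) = timed_map (\<lambda>\<sigma>. let (d, v) = compute_degree Ss \<sigma> in ((\<sigma>, d), v + 1)) \<Sigma>s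
      in (ds, t + u))"

definition compute_index :: "('v set \<times> nat) list \<Rightarrow> 'v \<Rightarrow> nat timed" where
  "compute_index ds x =
     (let (m, t) = timed_fold (\<lambda>(\<sigma>, d) m.
            if {x} \<subseteq> \<sigma> then (Some (case m of None \<Rightarrow> d | Some e \<Rightarrow> min d e), 3) else (m, 1)) ds None
      in (case m of None \<Rightarrow> 0 | Some e \<Rightarrow> e, t + 1))"

text \<open>Recompute the degrees, then the indices of all vertices whose current index is not \<open>-1\<close>.\<close>

definition update_indices ::
  "nat \<Rightarrow> 'v set list \<Rightarrow> ('v \<Rightarrow> int) \<Rightarrow> ('v \<Rightarrow> int) timed" where
  "update_indices k\<^sub>0 Ss I =
     (let (ds, t1) = compute_degrees k\<^sub>0 Ss;
          (xs, t2) = list_vertices Ss;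
          (I', t3) = timed_fold (\<lambda>x J. if J x = - 1 then (J, 2)
                        else let (i, t) = compute_index ds x in (J(x := int i), t + 3)) xs I
      in (I', t1 + t2 + t3))"

text \<open>The maximum of the current indices and the vertices attaining it (\<open>-1\<close> if there is no vertex).\<close>

definition max_index :: "'v set list \<Rightarrow> ('v \<Rightarrow> int) \<Rightarrow> (int \<times> 'v list) timed" where
  "max_index Ss I =
     (let (xs, t1) = list_vertices Ss;
          (m, t2) = timed_fold (\<lambda>x m. (max m (I x), 2)) xs (- 1);
          (ys, t3) = timed_filter (\<lambda>x. I x = m) xs
      in ((m, ys), t1 + t2 + t3))"


section \<open>Correctness of the computations\<close>

text \<open>The instrumented computations return the degrees, indices and Betti numbers defined above.\<close>

lemma timed_filter_fst [simp]: "fst (timed_filter P xs) = filter P xs"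
  by (induction xs) (auto split: prod.splits)

lemma timed_map_fst [simp]: "fst (timed_map f xs) = map (\<lambda>x. fst (f x)) xs"
  by (induction xs) (auto split: prod.splits)

lemma timed_fold_fst: "fst (timed_fold f xs a) = fold (\<lambda>x a. fst (f x a)) xs a"
  by (induction xs arbitrary: a) (simp_all add: split_beta Let_def)

lemma complexD:
  assumes "abstract_complex S" and "\<sigma> \<in> S"
  shows "finite \<sigma>" and "\<sigma> \<noteq> {}" and "\<tau> \<noteq> {} \<Longrightarrow> \<tau> \<subseteq> \<sigma> \<Longrightarrow> \<tau> \<in> S"
  using bspec[OF assms(1)[unfolded abstract_complex_def] assms(2)] by simp_all

lemma fold_if_filter: "fold (\<lambda>x m. if P x then g x m else m) xs a = fold g (filter P xs) a"
  by (induction xs arbitrary: a) auto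

lemma compute_degree_correct:
  assumes "abstract_complex (set Ss)" and "\<sigma> \<in> set Ss"
  shows "fst (compute_degree Ss \<sigma>) = simplex_degree (set Ss) \<sigma>"
proof -
  let ?A = "(\<lambda>\<tau>. card \<tau> - 1) ` {\<tau> \<in> set Ss. \<sigma> \<subseteq> \<tau>}"
  let ?xs = "filter (\<lambda>\<tau>. \<sigma> \<subseteq> \<tau>) Ss"
  have "fold (\<lambda>\<tau> d. max d (card \<tau> - 1)) xs a = fold max (map (\<lambda>\<tau>. card \<tau> - 1) xs) a"
    for xs :: "'a set list" and a
    by (induction xs arbitrary: a) (auto simp: max.commute)
  then have "fst (compute_degree Ss \<sigma>) = fold max (map (\<lambda>\<tau>. card \<tau> - 1) ?xs) 0"
    by (simp add: compute_degree_def timed_fold_fst if_distrib fold_if_filter cong: if_cong)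
  also have "\<dots> = Max (insert 0 ?A)"
    by (subst Max.set_eq_fold[symmetric]) simp
  also have "\<dots> = Max ?A"
    using assms(2) by (subst Max_insert) auto
  also have "?A = {d. \<exists>\<tau> \<in> simplices d (set Ss). \<sigma> \<subseteq> \<tau>}"
  proof -
    have "card \<tau> > 0" if "\<tau> \<in> set Ss" for \<tau>
      using complexD(1,2)[OF assms(1) that] by (simp add: card_gt_0_iff)
    then have "\<tau> \<in> simplices d (set Ss) \<longleftrightarrow> \<tau> \<in> set Ss \<and> d = card \<tau> - 1" for \<tau> d
      by (force simp: simplices_def)
    then show ?thesis
      by auto
  qed
  finally show ?thesis
    by (simp add: simplex_degree_def)
qed

lemma compute_index_correct:
  assumes "abstract_complex (set Ss)"
  shows "fst (compute_index (fst (compute_degrees k\<^sub>0 Ss)) x) = vertex_index k\<^sub>0 (set Ss) x"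
proof -
  define D where "D = (\<lambda>\<sigma>. (\<sigma>, simplex_degree (set Ss) \<sigma>))"
  define m where "m = (\<lambda>m. case m of None \<Rightarrow> (0 :: nat) | Some e \<Rightarrow> e)"
  let ?f = "\<lambda>(\<sigma>, d) m. if x \<in> \<sigma> then Some (case m of None \<Rightarrow> d | Some e \<Rightarrow> min d e) else m"
  have ds: "fst (compute_degrees k\<^sub>0 Ss) = map D (filter (\<lambda>\<sigma>. card \<sigma> = k\<^sub>0 + 2) Ss)"
    using assms by (auto simp: compute_degrees_def D_def split_beta Let_def compute_degree_correct)
  let ?g = "\<lambda>p m. Some (case m of None \<Rightarrow> snd p | Some e \<Rightarrow> min (snd p) e)"
  have fg: "fold ?f ds z = fold ?g (filter (\<lambda>p. x \<in> fst p) ds) z" for ds z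
    by (simp add: fold_if_filter[symmetric] split_def)
  have some: "fold ?g ps (Some e) = Some (fold min (map snd ps) e)" for ps :: "('a set \<times> nat) list" and e
    by (induction ps arbitrary: e) auto
  have none: "fold ?f ds None = (if \<exists>p \<in> set ds. x \<in> fst p
      then Some (Min (snd ` {p \<in> set ds. x \<in> fst p})) else None)" for ds :: "('a set \<times> nat) list"
  proof (cases "filter (\<lambda>p. x \<in> fst p) ds")
    case Nil
    then show ?thesis
      by (auto simp: fg filter_empty_conv)
  next
    case (Cons p ps)
    then have "{p \<in> set ds. x \<in> fst p} = set (p # ps)"
      by (metis set_filter)
    then have "snd ` {p \<in> set ds. x \<in> fst p} = set (snd p # map snd ps)" "\<exists>p \<in> set ds. x \<in> fst p"
      by auto
    then show ?thesis
      by (simp add: fg Cons some Min.set_eq_fold del: set_simps)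
  qed
  have f: "(\<lambda>p m. fst ((\<lambda>(\<sigma>, d) m. if {x} \<subseteq> \<sigma>
        then (Some (case m of None \<Rightarrow> d | Some e \<Rightarrow> min d e), 3 :: nat) else (m, 1)) p m)) = ?f"
    by (auto simp: fun_eq_iff)
  have "fst (compute_index ds x) = m (fold ?f ds None)" for ds
    unfolding m_def f[symmetric] by (simp add: compute_index_def timed_fold_fst split_beta Let_def)
  moreover have "set (filter (\<lambda>\<sigma>. card \<sigma> = k\<^sub>0 + 2) Ss) = simplices (k\<^sub>0 + 1) (set Ss)"
    by (auto simp: simplices_def)
  moreover have "snd ` {p \<in> D ` A. x \<in> fst p} = simplex_degree (set Ss) ` {\<sigma> \<in> A. x \<in> \<sigma>}" for A
    by (force simp: D_def)
  moreover have "(\<exists>p \<in> D ` A. x \<in> fst p) \<longleftrightarrow> (\<exists>\<sigma> \<in> A. x \<in> \<sigma>)" for A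
    by (auto simp: D_def)
  ultimately show ?thesis
    unfolding ds by (simp add: none m_def vertex_index_def del: set_filter)
qed

lemma boundary_linear:
  "Vector_Spaces.linear (\<lambda>c f \<sigma>. c * f \<sigma>) (\<lambda>c f \<sigma>. c * f \<sigma>) (boundary k S :: ('v :: linorder set \<Rightarrow> 'f :: field) \<Rightarrow> _)"
  unfolding Vector_Spaces.linear_iff
  by (auto simp: chain.vector_space_axioms boundary_def fun_eq_iff sum.distrib sum_distrib_left
      algebra_simps)

definition basis_chain :: "'v set \<Rightarrow> 'v set \<Rightarrow> 'f :: field" where
  "basis_chain \<sigma> = (\<lambda>\<tau>. if \<tau> = \<sigma> then 1 else 0)"

lemma fun_sum_apply: "(\<Sum>i\<in>A. f i) x = (\<Sum>i\<in>A. f i x)"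
  by (induction A rule: infinite_finite_induct) auto

lemma simplices_finite: "finite S \<Longrightarrow> finite (simplices k S)"
  by (simp add: simplices_def)

lemma chain_space_span:
  assumes "finite S"
  shows "chain.span (basis_chain ` simplices k S) = (chain_space k S :: ('v set \<Rightarrow> 'f :: field) set)"
proof
  have "chain.subspace (chain_space k S :: ('v set \<Rightarrow> 'f) set)"
    by (auto simp: chain.subspace_def chain_space_def)
  then show "chain.span (basis_chain ` simplices k S) \<subseteq> (chain_space k S :: ('v set \<Rightarrow> 'f) set)"
    by (rule chain.span_minimal[rotated]) (auto simp: chain_space_def basis_chain_def)
  show "(chain_space k S :: ('v set \<Rightarrow> 'f) set) \<subseteq> chain.span (basis_chain ` simplices k S)"
  proof
    fix c :: "'v set \<Rightarrow> 'f"
    assume c: "c \<in> chain_space k S"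
    have "c = (\<Sum>\<sigma>\<in>simplices k S. (\<lambda>\<tau>. c \<sigma> * basis_chain \<sigma> \<tau>))"
    proof
      fix \<tau>
      have "(\<Sum>\<sigma>\<in>simplices k S. c \<sigma> * basis_chain \<sigma> \<tau>) = (\<Sum>\<sigma>\<in>simplices k S. if \<sigma> = \<tau> then c \<sigma> else 0)"
        by (rule sum.cong) (auto simp: basis_chain_def)
      also have "\<dots> = c \<tau>"
        using c simplices_finite[OF assms, of k] by (auto simp: chain_space_def sum.delta)
      finally show "c \<tau> = (\<Sum>\<sigma>\<in>simplices k S. (\<lambda>\<tau>. c \<sigma> * basis_chain \<sigma> \<tau>)) \<tau>"
        by (simp add: fun_sum_apply)
    qed
    also have "\<dots> \<in> chain.span (basis_chain ` simplices k S)"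
      by (intro chain.span_sum chain.span_scale chain.span_base) auto
    finally show "c \<in> chain.span (basis_chain ` simplices k S)" .
  qed
qed

lemma chain_space_dim:
  assumes "finite S"
  shows "chain.dim (chain_space k S :: ('v set \<Rightarrow> 'f :: field) set) = card (simplices k S)"
proof -
  let ?B = "basis_chain ` simplices k S :: ('v set \<Rightarrow> 'f) set"
  have inj: "inj_on (basis_chain :: 'v set \<Rightarrow> 'v set \<Rightarrow> 'f) (simplices k S)"
    by (rule inj_onI) (metis basis_chain_def zero_neq_one)
  have "chain.independent ?B"
  proof (rule chain.independent_if_scalars_zero)
    show "finite ?B"
      using assms by (simp add: simplices_finite)
    fix f and x :: "'v set \<Rightarrow> 'f"
    assume sum: "(\<Sum>x\<in>?B. (\<lambda>\<sigma>. f x * x \<sigma>)) = 0" and "x \<in> ?B"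
    then obtain \<tau> where \<tau>: "\<tau> \<in> simplices k S" "x = basis_chain \<tau>"
      by auto
    have "0 = (\<Sum>x\<in>?B. (\<lambda>\<sigma>. f x * x \<sigma>)) \<tau>"
      using sum by simp
    also have "\<dots> = (\<Sum>\<sigma>\<in>simplices k S. f (basis_chain \<sigma>) * basis_chain \<sigma> \<tau>)"
      by (simp add: fun_sum_apply sum.reindex[OF inj])
    also have "\<dots> = (\<Sum>\<sigma>\<in>simplices k S. if \<sigma> = \<tau> then f (basis_chain \<sigma>) else 0)"
      by (rule sum.cong) (auto simp: basis_chain_def)
    also have "\<dots> = f x"
      using \<tau> simplices_finite[OF assms, of k] by (simp add: sum.delta)
    finally show "f x = 0"
      by simp
  qed
  then have "chain.dim (chain.span ?B) = card ?B"
    by (rule chain.dim_span_eq_card_independent)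
  then show ?thesis
    by (simp add: chain_space_span[OF assms] card_image[OF inj])
qed

lemma rank_nullity:
  fixes U :: "('v :: linorder set \<Rightarrow> 'f :: field) set"
  assumes "Vector_Spaces.linear (\<lambda>c f \<sigma>. c * f \<sigma>) (\<lambda>c f \<sigma>. c * f \<sigma>) (h :: ('v set \<Rightarrow> 'f) \<Rightarrow> 'v set \<Rightarrow> 'f)"
    and "chain.subspace U" and "U \<subseteq> chain.span W" and "finite W"
  shows "chain.dim U = chain.dim {u \<in> U. h u = 0} + chain.dim (h ` U)"
proof -
  interpret h: Vector_Spaces.linear "\<lambda>c f \<sigma>. c * f \<sigma>" "\<lambda>c f \<sigma>. c * f \<sigma>" h
    by fact
  interpret pair: vector_space_pair "\<lambda>(c :: 'f) f (\<sigma> :: 'v set). c * f \<sigma>" "\<lambda>(c :: 'f) f (\<sigma> :: 'v set). c * f \<sigma>"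
    by unfold_locales
  let ?N = "{u \<in> U. h u = 0}"
  obtain A where A: "A \<subseteq> ?N" "chain.independent A" "?N \<subseteq> chain.span A" "card A = chain.dim ?N"
    by (rule chain.basis_exists)
  obtain B where B: "A \<subseteq> B" "B \<subseteq> U" "chain.independent B" "U \<subseteq> chain.span B"
    using chain.maximal_independent_subset_extend[of A U] A by blast
  have finB: "finite B"
    using chain.independent_span_bound[of W B] assms B by blast
  have spanB: "chain.span B = U"
    using B assms(2) chain.span_minimal by blast
  define C where "C = B - A"
  have indC: "chain.independent C"
    using B chain.independent_mono C_def by blast
  have disjoint: "x = 0" if "x \<in> chain.span A" "x \<in> chain.span C" for x
  proof -
    have "chain.representation B x = chain.representation A x"
      "chain.representation B x = chain.representation C x"
      using that B by (auto intro!: chain.representation_extend simp: C_def)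
    then have "chain.representation B x b = 0" for b
      using chain.representation_ne_zero[of A x b] chain.representation_ne_zero[of C x b]
      by (auto simp: C_def)
    moreover have "x \<in> chain.span B"
      using that chain.span_mono[OF B(1)] by blast
    ultimately show ?thesis
      using chain.sum_nonzero_representation_eq[OF B(3), of x] by simp
  qed
  have inj: "inj_on h (chain.span C)"
  proof (subst h.inj_on_iff_eq_0)
    show "\<forall>x\<in>chain.span C. h x = 0 \<longrightarrow> x = 0"
    proof (intro ballI impI)
      fix x assume x: "x \<in> chain.span C" "h x = 0"
      then have "x \<in> U"
        using spanB chain.span_mono[of C B] by (auto simp: C_def)
      then have "x \<in> chain.span A"
        using x A by auto
      then show "x = 0"
        using x disjoint by blast
    qed
  qed (simp add: chain.subspace_span)
  have "h ` U = chain.span (h ` B)"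
    using h.span_image[of B] spanB by simp
  also have "\<dots> = chain.span (h ` C)"
  proof (rule antisym)
    have "h b \<in> chain.span (h ` C)" if "b \<in> B" for b
      using that A B by (cases "b \<in> A") (auto simp: C_def chain.span_zero intro: chain.span_base)
    then show "chain.span (h ` B) \<subseteq> chain.span (h ` C)"
      by (intro chain.span_minimal) (auto simp: chain.subspace_span)
  qed (auto simp: C_def intro!: chain.span_mono)
  finally have "chain.dim (h ` U) = card (h ` C)"
    using h.independent_inj_on_image[OF indC inj] chain.dim_span_eq_card_independent by simp
  also have "\<dots> = card C"
    using inj chain.span_superset[of C] by (meson card_image inj_on_subset)
  also have "card C + card A = card B"
    using B finB by (simp add: C_def card_Diff_subset finite_subset card_mono)
  moreover have "card B = chain.dim U"
    using B chain.basis_card_eq_dim by blast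
  ultimately show ?thesis
    using A by simp
qed

lemma incidence_sum:
  assumes "finite F" and "\<And>v. v \<in> \<sigma> \<Longrightarrow> \<sigma> - {v} \<in> F \<or> g (\<sigma> - {v}) = 0"
  shows "(\<Sum>\<tau>\<in>F. g \<tau> * incidence \<tau> \<sigma>) =
    (\<Sum>v\<in>\<sigma>. (- 1) ^ card {w \<in> \<sigma>. w < v} * g (\<sigma> - {v}) :: 'f :: field)"
proof -
  have "(\<Sum>\<tau>\<in>F. g \<tau> * incidence \<tau> \<sigma>) =
      (\<Sum>\<tau>\<in>F. \<Sum>v\<in>\<sigma>. if \<tau> = \<sigma> - {v} then (- 1) ^ card {w \<in> \<sigma>. w < v} * g (\<sigma> - {v}) else 0)"
    unfolding incidence_def sum_distrib_left by (intro sum.cong) auto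
  also have "\<dots> = (\<Sum>v\<in>\<sigma>. \<Sum>\<tau>\<in>F. if \<tau> = \<sigma> - {v} then (- 1) ^ card {w \<in> \<sigma>. w < v} * g (\<sigma> - {v}) else 0)"
    by (rule sum.swap)
  also have "\<dots> = (\<Sum>v\<in>\<sigma>. (- 1) ^ card {w \<in> \<sigma>. w < v} * g (\<sigma> - {v}))"
    using assms by (intro sum.cong) (auto simp: sum.delta)
  finally show ?thesis .
qed

lemma incidence_incidence:
  fixes \<sigma> :: "'v :: linorder set"
  assumes "finite \<sigma>"
  shows "(\<Sum>v\<in>\<sigma>. (- 1) ^ card {w \<in> \<sigma>. w < v} * incidence \<rho> (\<sigma> - {v}) :: 'f :: field) = 0"
proof -
  define s :: "'v \<Rightarrow> 'v \<Rightarrow> 'f" where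
    "s v w = (if \<sigma> - {v} - {w} = \<rho> then
       (- 1) ^ card {u \<in> \<sigma>. u < v} * (- 1) ^ card {u \<in> \<sigma> - {v}. u < w} else 0)" for v w
  have anti: "s w v = - s v w" if "v \<in> \<sigma>" "w \<in> \<sigma>" "v < w" for v w
  proof -
    have 1: "{u \<in> \<sigma> - {w}. u < v} = {u \<in> \<sigma>. u < v}"
      using that by auto
    have "{u \<in> \<sigma>. u < w} = insert v {u \<in> \<sigma> - {v}. u < w}"
      using that by auto
    then have 2: "card {u \<in> \<sigma>. u < w} = Suc (card {u \<in> \<sigma> - {v}. u < w})"
      using assms by (metis (no_types, lifting) Diff_iff card_insert_disjoint finite_Diff finite_subset insertI1 mem_Collect_eq subsetI)
    have "\<sigma> - {w} - {v} = \<sigma> - {v} - {w}"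
      by auto
    then show ?thesis
      unfolding s_def 1 2 by simp
  qed
  have fin: "finite \<sigma>" "finite {p \<in> \<sigma> \<times> \<sigma>. fst p < snd p}" "finite {p \<in> \<sigma> \<times> \<sigma>. snd p < fst p}"
    using assms by auto
  have "(\<Sum>v\<in>\<sigma>. (- 1) ^ card {w \<in> \<sigma>. w < v} * incidence \<rho> (\<sigma> - {v}) :: 'f) = (\<Sum>v\<in>\<sigma>. \<Sum>w\<in>\<sigma> - {v}. s v w)"
    unfolding incidence_def sum_distrib_left s_def by (intro sum.cong) auto
  also have "\<dots> = (\<Sum>(v, w)\<in>(SIGMA v:\<sigma>. \<sigma> - {v}). s v w)"
    using assms by (intro sum.Sigma) auto
  also have "(SIGMA v:\<sigma>. \<sigma> - {v}) = {p \<in> \<sigma> \<times> \<sigma>. fst p < snd p} \<union> {p \<in> \<sigma> \<times> \<sigma>. snd p < fst p}"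
    by auto
  also have "(\<Sum>(v, w)\<in>\<dots>. s v w) =
      (\<Sum>(v, w)\<in>{p \<in> \<sigma> \<times> \<sigma>. fst p < snd p}. s v w) + (\<Sum>(v, w)\<in>{p \<in> \<sigma> \<times> \<sigma>. snd p < fst p}. s v w)"
    using fin by (intro sum.union_disjoint) auto
  also have "(\<Sum>(v, w)\<in>{p \<in> \<sigma> \<times> \<sigma>. snd p < fst p}. s v w) =
      (\<Sum>(v, w)\<in>{p \<in> \<sigma> \<times> \<sigma>. fst p < snd p}. s w v)"
    by (rule sum.reindex_bij_witness[of _ prod.swap prod.swap]) auto
  also have "\<dots> = - (\<Sum>(v, w)\<in>{p \<in> \<sigma> \<times> \<sigma>. fst p < snd p}. s v w)"
    unfolding sum_negf[symmetric] by (intro sum.cong) (auto simp: anti)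
  finally show ?thesis
    by simp
qed

lemma facet_in_complex:
  assumes "abstract_complex S" and "\<sigma> \<in> S" and "card \<sigma> = k + 1" and "v \<in> \<sigma>" and "\<sigma> - {v} \<noteq> {}"
  shows "\<sigma> - {v} \<in> S \<and> card (\<sigma> - {v}) = k"
proof
  show "\<sigma> - {v} \<in> S"
    by (rule complexD(3)[OF assms(1,2,5)]) simp
  show "card (\<sigma> - {v}) = k"
    using assms(3,4) complexD(1)[OF assms(1,2)] by simp
qed

lemma boundary_boundary:
  fixes c :: "'v :: linorder set \<Rightarrow> 'f :: field"
  assumes "abstract_complex S" and "finite S"
  shows "boundary k S (boundary (k + 1) S c) = 0"
proof
  fix \<rho>
  show "boundary k S (boundary (k + 1) S c) \<rho> = 0 \<rho>"
  proof (cases "\<rho> = {}")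
    case False
    have 1: "{} \<notin> simplices k S"
      by (auto simp: simplices_def)
    have inner: "(\<Sum>\<tau>\<in>simplices k S. incidence \<rho> \<tau> * incidence \<tau> \<sigma>) = (0 :: 'f)"
      if \<sigma>: "\<sigma> \<in> simplices (k + 1) S" for \<sigma>
    proof -
      have fin: "finite \<sigma>"
        using complexD(1)[OF assms(1)] \<sigma> by (simp add: simplices_def)
      have "\<sigma> - {v} \<in> simplices k S" if "v \<in> \<sigma>" for v
      proof -
        have "card (\<sigma> - {v}) = k + 1"
          using \<sigma> that fin by (simp add: simplices_def)
        then have "\<sigma> - {v} \<noteq> {}"
          by force
        then show ?thesis
          using \<sigma> that facet_in_complex[OF assms(1), of \<sigma> "k + 1" v] by (simp add: simplices_def)
      qed
      then have "(\<Sum>\<tau>\<in>simplices k S. incidence \<rho> \<tau> * incidence \<tau> \<sigma>) =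
          (\<Sum>v\<in>\<sigma>. (- 1) ^ card {w \<in> \<sigma>. w < v} * incidence \<rho> (\<sigma> - {v}) :: 'f)"
        using assms(2) by (intro incidence_sum) (auto simp: simplices_finite)
      then show ?thesis
        using incidence_incidence[OF fin] by simp
    qed
    have "boundary k S (boundary (k + 1) S c) \<rho> =
        (\<Sum>\<tau>\<in>simplices k S. (\<Sum>\<sigma>\<in>simplices (k + 1) S. c \<sigma> * incidence \<tau> \<sigma>) * incidence \<rho> \<tau>)"
      using False
      by (subst boundary_def, simp, intro sum.cong)
        (auto simp: boundary_def simplices_def)
    also have "\<dots> = (\<Sum>\<sigma>\<in>simplices (k + 1) S. \<Sum>\<tau>\<in>simplices k S. c \<sigma> * (incidence \<rho> \<tau> * incidence \<tau> \<sigma>))"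
      unfolding sum_distrib_right by (subst sum.swap) (simp add: mult_ac)
    also have "\<dots> = 0"
      using inner by (simp add: sum_distrib_left[symmetric])
    finally show ?thesis
      by simp
  qed (simp add: boundary_def)
qed

lemma boundary_chains:
  fixes c :: "'v :: linorder set \<Rightarrow> 'f :: field"
  assumes "abstract_complex S"
  shows "boundary (k + 1) S c \<in> chain_space k S"
proof -
  have "incidence \<tau> \<sigma> = (0 :: 'f)" if "\<tau> \<noteq> {}" "\<tau> \<notin> simplices k S" "\<sigma> \<in> simplices (k + 1) S" for \<tau> \<sigma>
    unfolding incidence_def
  proof (rule sum.neutral, intro ballI)
    fix v assume v: "v \<in> \<sigma>"
    have "\<sigma> - {v} \<noteq> \<tau>"
      using v that facet_in_complex[OF assms, of \<sigma> "k + 1" v] by (auto simp: simplices_def)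
    then show "(if \<sigma> - {v} = \<tau> then (- 1) ^ card {w \<in> \<sigma>. w < v} else 0) = (0 :: 'f)"
      using that by simp
  qed
  then show ?thesis
    by (auto simp: chain_space_def boundary_def)
qed

lemma betti_eq_ranks:
  assumes "abstract_complex S" and "finite (S :: 'v :: linorder set set)"
  shows "betti TYPE('f :: field) k S = card (simplices k S)
      - chain.dim (boundary k S ` chain_space k S :: ('v set \<Rightarrow> 'f) set)
      - chain.dim (boundary (k + 1) S ` chain_space (k + 1) S :: ('v set \<Rightarrow> 'f) set)"
proof -
  let ?Z = "cycles k S :: ('v set \<Rightarrow> 'f) set" and ?D = "boundaries k S :: ('v set \<Rightarrow> 'f) set"
  have subC: "chain.subspace (chain_space j S :: ('v set \<Rightarrow> 'f) set)" for j
    by (metis chain.subspace_span chain_space_span[OF assms(2)])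
  have linear: "Vector_Spaces.linear (\<lambda>c f \<sigma>. c * f \<sigma>) (\<lambda>c f \<sigma>. c * f \<sigma>) (boundary j S :: ('v set \<Rightarrow> 'f) \<Rightarrow> _)" for j
    by (rule boundary_linear)
  interpret h: Vector_Spaces.linear "\<lambda>c f \<sigma>. c * f \<sigma>" "\<lambda>c f \<sigma>. c * f \<sigma>" "boundary (k + 1) S :: ('v set \<Rightarrow> 'f) \<Rightarrow> _"
    by (rule linear)
  interpret g: Vector_Spaces.linear "\<lambda>c f \<sigma>. c * f \<sigma>" "\<lambda>c f \<sigma>. c * f \<sigma>" "boundary k S :: ('v set \<Rightarrow> 'f) \<Rightarrow> _"
    by (rule linear)
  have subD: "chain.subspace ?D"
    unfolding boundaries_def by (rule h.subspace_image[OF subC])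
  have subZ: "chain.subspace ?Z"
    using subC[of k] by (auto simp: cycles_def chain.subspace_def g.add g.scale g.zero)
  have DZ: "?D \<subseteq> ?Z"
    using boundary_boundary[OF assms] boundary_chains[OF assms(1)]
    by (auto simp: boundaries_def cycles_def)
  have bound: "?Z \<subseteq> chain.span (basis_chain ` simplices k S)"
    by (auto simp: cycles_def chain_space_span[OF assms(2)])
  obtain B0 where B0: "B0 \<subseteq> ?D" "chain.independent B0" "?D \<subseteq> chain.span B0" "card B0 = chain.dim ?D"
    by (rule chain.basis_exists)
  obtain B where B: "B0 \<subseteq> B" "B \<subseteq> ?Z" "chain.independent B" "?Z \<subseteq> chain.span B"
    using chain.maximal_independent_subset_extend[of B0 ?Z] B0 DZ by blast
  have finB: "finite B"
    using chain.independent_span_bound[of "basis_chain ` simplices k S" B] B bound assms(2)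
    by (auto simp: simplices_finite)
  have cardB: "card B = chain.dim ?Z"
    using B chain.basis_card_eq_dim by blast
  have spanB0: "chain.span B0 = ?D"
    using B0 subD chain.span_minimal by blast
  have "betti TYPE('f) k S = chain.dim ?Z - chain.dim ?D"
    unfolding betti_def
  proof (rule Least_equality)
    have "\<exists>u \<in> chain.span (B - B0). z - u \<in> ?D" if "z \<in> ?Z" for z
    proof -
      have "z \<in> chain.span (B0 \<union> (B - B0))"
        using that B by (auto simp: Un_absorb1)
      then obtain d u where "d \<in> chain.span B0" "u \<in> chain.span (B - B0)" "z = d + u"
        unfolding chain.span_Un by auto
      then show ?thesis
        using spanB0 by (intro bexI[of _ u]) auto
    qed
    moreover have "card (B - B0) = chain.dim ?Z - chain.dim ?D"
      using B finB B0 cardB by (simp add: card_Diff_subset finite_subset)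
    ultimately show "\<exists>A. A \<subseteq> ?Z \<and> finite A \<and> card A = chain.dim ?Z - chain.dim ?D \<and>
        (\<forall>z\<in>?Z. \<exists>u\<in>chain.span A. z - u \<in> ?D)"
      using B finB by (intro exI[of _ "B - B0"]) auto
  next
    fix m
    assume "\<exists>A. A \<subseteq> ?Z \<and> finite A \<and> card A = m \<and> (\<forall>z\<in>?Z. \<exists>u\<in>chain.span A. z - u \<in> ?D)"
    then obtain A where A: "finite A" "card A = m" "\<forall>z\<in>?Z. \<exists>u\<in>chain.span A. z - u \<in> ?D"
      by blast
    have "?Z \<subseteq> chain.span (A \<union> B0)"
    proof
      fix z assume "z \<in> ?Z"
      then obtain u where "u \<in> chain.span A" "z - u \<in> chain.span B0"
        using A spanB0 by blast
      then have "u + (z - u) \<in> chain.span (A \<union> B0)"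
        using chain.span_mono[of A "A \<union> B0"] chain.span_mono[of B0 "A \<union> B0"]
        by (intro chain.span_add) auto
      then show "z \<in> chain.span (A \<union> B0)"
        by simp
    qed
    then have "chain.dim ?Z \<le> card (A \<union> B0)"
      using A B finB by (intro chain.dim_le_card) (auto intro: finite_subset)
    also have "\<dots> \<le> m + chain.dim ?D"
      using card_Un_le[of A B0] A B0 by simp
    finally show "chain.dim ?Z - chain.dim ?D \<le> m"
      by simp
  qed
  moreover have "chain.dim (chain_space k S :: ('v set \<Rightarrow> 'f) set) =
      chain.dim ?Z + chain.dim (boundary k S ` chain_space k S :: ('v set \<Rightarrow> 'f) set)"
    unfolding cycles_def using assms(2)
    by (intro rank_nullity[OF linear subC, of _ "basis_chain ` simplices k S"])
      (auto simp: chain_space_span simplices_finite)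
  ultimately show ?thesis
    by (simp add: chain_space_dim[OF assms(2)] boundaries_def)
qed

lemma boundary_column_fst:
  "fst (boundary_column Rs \<sigma>) = (\<lambda>\<tau>. if \<tau> \<in> set Rs then incidence \<tau> \<sigma> else 0)"
proof -
  have "fold (\<lambda>\<tau> col. col(\<tau> := g \<tau>)) Rs c = (\<lambda>\<tau>. if \<tau> \<in> set Rs then g \<tau> else c \<tau>)" for c g
    by (induction Rs arbitrary: c) (auto simp: fun_eq_iff)
  then show ?thesis
    by (simp add: boundary_column_def timed_fold_fst)
qed

lemma boundary_rank_correct:
  fixes Ss :: "'v :: linorder set list"
  assumes "abstract_complex (set Ss)"
  shows "fst (boundary_rank TYPE('f :: field) rc k Ss) =
    chain.dim (boundary k (set Ss) ` chain_space k (set Ss) :: ('v set \<Rightarrow> 'f) set)"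
proof -
  let ?S = "set Ss"
  interpret h: Vector_Spaces.linear "\<lambda>c f \<sigma>. c * f \<sigma>" "\<lambda>c f \<sigma>. c * f \<sigma>" "boundary k ?S :: ('v set \<Rightarrow> 'f) \<Rightarrow> _"
    by (rule boundary_linear)
  let ?Rs = "filter (\<lambda>\<sigma>. card \<sigma> = k) Ss"
  have col: "fst (boundary_column ?Rs \<sigma>) = (boundary k ?S (basis_chain \<sigma>) :: 'v set \<Rightarrow> 'f)"
    if \<sigma>: "\<sigma> \<in> simplices k ?S" for \<sigma>
  proof
    fix \<tau>
    have "(\<Sum>\<sigma>'\<in>simplices k ?S. basis_chain \<sigma> \<sigma>' * incidence \<tau> \<sigma>') =
        (\<Sum>\<sigma>'\<in>simplices k ?S. if \<sigma>' = \<sigma> then incidence \<tau> \<sigma> else (0 :: 'f))"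
      by (rule sum.cong) (auto simp: basis_chain_def)
    also have "\<dots> = incidence \<tau> \<sigma>"
      using \<sigma> by (simp add: sum.delta simplices_finite)
    finally have 1: "boundary k ?S (basis_chain \<sigma>) \<tau> = (if \<tau> = {} then 0 else incidence \<tau> \<sigma> :: 'f)"
      by (simp add: boundary_def)
    have 2: "incidence \<tau> \<sigma> = (0 :: 'f)" if "\<tau> \<noteq> {}" "\<not> (\<tau> \<in> ?S \<and> card \<tau> = k)"
      unfolding incidence_def
    proof (rule sum.neutral, intro ballI)
      fix v assume v: "v \<in> \<sigma>"
      have "\<sigma> - {v} \<noteq> \<tau>"
        using v that \<sigma> facet_in_complex[OF assms, of \<sigma> k v] by (auto simp: simplices_def)
      then show "(if \<sigma> - {v} = \<tau> then (- 1) ^ card {w \<in> \<sigma>. w < v} else 0) = (0 :: 'f)"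
        using that by simp
    qed
    have 3: "{} \<notin> ?S"
      using complexD(2)[OF assms] by blast
    show "fst (boundary_column ?Rs \<sigma>) \<tau> = (boundary k ?S (basis_chain \<sigma>) \<tau> :: 'f)"
      unfolding boundary_column_fst 1 using 2 3 by auto
  qed
  have Cs: "set (filter (\<lambda>\<sigma>. card \<sigma> = k + 1) Ss) = simplices k ?S"
    by (auto simp: simplices_def)
  have "fst (boundary_rank TYPE('f) rc k Ss) =
      chain.dim ((\<lambda>\<sigma>. fst (boundary_column ?Rs \<sigma>) :: 'v set \<Rightarrow> 'f) ` simplices k ?S)"
    unfolding Cs[symmetric] by (simp add: boundary_rank_def split_beta Let_def del: set_filter)
  also have "(\<lambda>\<sigma>. fst (boundary_column ?Rs \<sigma>) :: 'v set \<Rightarrow> 'f) ` simplices k ?S =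
      boundary k ?S ` basis_chain ` simplices k ?S"
    using col by (auto simp: image_image)
  also have "chain.dim \<dots> = chain.dim (chain.span \<dots>)"
    by simp
  also have "chain.span (boundary k ?S ` basis_chain ` simplices k ?S) =
      (boundary k ?S ` chain_space k ?S :: ('v set \<Rightarrow> 'f) set)"
    unfolding h.span_image by (simp add: chain_space_span)
  finally show ?thesis .
qed

lemma compute_betti_correct:
  assumes "abstract_complex (set Ss)" and "distinct Ss"
  shows "fst (compute_betti TYPE('f :: field) rc Ss k) = betti TYPE('f) k (set Ss)"
proof -
  have "fold (\<lambda>_ m. m + 1) xs a = a + length xs" for xs :: "'a set list" and a :: nat
    by (induction xs arbitrary: a) auto
  moreover have "length (filter (\<lambda>\<sigma>. card \<sigma> = k + 1) Ss) = card (simplices k (set Ss))"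
    using assms(2) by (simp add: simplices_def distinct_length_filter Int_def conj_commute)
  ultimately show ?thesis
    using assms(1)
    by (simp add: compute_betti_def split_beta Let_def timed_fold_fst boundary_rank_correct
        betti_eq_ranks)
qed

lemma vietoris_rips_complex:
  "abstract_complex (vietoris_rips a r n P)" and "finite (vietoris_rips a r n P)"
proof -
  have "finite \<sigma>" if "\<sigma> \<subseteq> {..<n}" for \<sigma> :: "nat set"
    using that by (rule finite_subset) simp
  then show "abstract_complex (vietoris_rips a r n P)"
    unfolding abstract_complex_def vietoris_rips_def by blast
  show "finite (vietoris_rips a r n P)"
    by (rule finite_subset[of _ "Pow {..<n}"]) (auto simp: vietoris_rips_def)
qed


section \<open>The reduction algorithm\<close>

definition try_remove ::
  "'f :: field itself \<Rightarrow> (nat \<Rightarrow> nat \<Rightarrow> nat) \<Rightarrow> nat \<Rightarrow> nat list \<Rightarrow>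
   'v :: linorder set list \<Rightarrow> ('v \<Rightarrow> int) \<Rightarrow> 'v \<Rightarrow> ('v set list \<times> ('v \<Rightarrow> int)) timed" where
  "try_remove F rc k\<^sub>0 bs Ss I x =
     (let (Ss', t1) = timed_filter (\<lambda>\<tau>. \<not> {x} \<subseteq> \<tau>) Ss;
          (bs', t2) = compute_bettis F rc k\<^sub>0 Ss';
          t3 = length bs
      in if bs' \<noteq> bs then ((Ss, I(x := - 1)), t1 + t2 + t3 + 1)
         else let (I', t4) = update_indices k\<^sub>0 Ss' I in ((Ss', I'), t1 + t2 + t3 + t4))"

lemma list_vertices_set: "set (fst (list_vertices Ss)) = {x. {x} \<in> set Ss}"
proof -
  have "set (fst (list_vertices Ss)) = the_elem ` {\<sigma> \<in> set Ss. card \<sigma> = 1}"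
    by (simp add: list_vertices_def split_beta)
  also have "\<dots> = {x. {x} \<in> set Ss}"
    by (force simp: card_1_singleton_iff)
  finally show ?thesis .
qed

lemma update_indices_critical:
  assumes "I x = - 1"
  shows "fst (update_indices k\<^sub>0 Ss I) x = - 1"
proof -
  have "fst (timed_fold (\<lambda>x J. if J x = - 1 then (J, 2)
      else let (i, t) = compute_index ds x in (J(x := int i), t + 3)) xs I) x = - 1" for ds xs
    using assms
  proof (induction xs arbitrary: I)
    case (Cons y xs)
    from Cons.prems have "I y \<noteq> - 1 \<Longrightarrow> (I(y := i)) x = - 1" for i
      by auto
    with Cons show ?case
      by (simp add: split_beta Let_def del: fun_upd_apply)
  qed simp
  then show ?thesis
    by (simp add: update_indices_def split_beta)
qed

lemma max_index_attained:
  assumes "max_index Ss I = ((m, ys), t)" and "m > - 1"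
  shows "ys \<noteq> []" and "x \<in> set ys \<Longrightarrow> {x} \<in> set Ss \<and> I x = m"
proof -
  let ?xs = "fst (list_vertices Ss)"
  have fold: "fold (\<lambda>x m. max m (I x)) xs a = a \<or> fold (\<lambda>x m. max m (I x)) xs a \<in> I ` set xs"
    for xs :: "'a list" and a
    by (induction xs arbitrary: a) (auto simp: max_def split: if_splits)
  have m: "m = fold (\<lambda>x m. max m (I x)) ?xs (- 1)" and ys: "ys = filter (\<lambda>x. I x = m) ?xs"
    using assms(1) by (auto simp: max_index_def split_beta timed_fold_fst)
  from fold[of ?xs "- 1"] assms(2) m have "\<exists>y \<in> set ?xs. I y = m"
    by auto
  then show "ys \<noteq> []"
    using ys by (auto simp: filter_empty_conv)
  show "x \<in> set ys \<Longrightarrow> {x} \<in> set Ss \<and> I x = m"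
    using ys list_vertices_set[of Ss] by auto
qed

lemma try_remove_decreases:
  assumes "{x} \<in> set Ss" and "I x \<noteq> - 1" and "try_remove F rc k\<^sub>0 bs Ss I x = ((Ss', I'), t)"
  shows "card {y. {y} \<in> set Ss' \<and> I' y \<noteq> - 1} < card {y. {y} \<in> set Ss \<and> I y \<noteq> - 1}"
proof (rule psubset_card_mono)
  have "finite {y. {y} \<in> set Ss}"
    using list_vertices_set[of Ss] by (metis List.finite_set)
  then show "finite {y. {y} \<in> set Ss \<and> I y \<noteq> - 1}"
    by (rule rev_finite_subset) auto
  have "set Ss' \<subseteq> set Ss" "I y = - 1 \<Longrightarrow> I' y = - 1" "{x} \<notin> set Ss' \<or> I' x = - 1" for y
    using assms(3) update_indices_critical[of I y k\<^sub>0]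
    by (auto simp: try_remove_def split_beta Let_def split: if_splits)
  then show "{y. {y} \<in> set Ss' \<and> I' y \<noteq> - 1} \<subset> {y. {y} \<in> set Ss \<and> I y \<noteq> - 1}"
    using assms(1,2) by blast
qed

text \<open>The main loop; the last argument counts the operations carried out so far. The Betti numbers
  \<open>bs\<close> of the initial complex are those of every later one.\<close>

function reduction_loop ::
  "'f :: field itself \<Rightarrow> (nat \<Rightarrow> nat \<Rightarrow> nat) \<Rightarrow> nat \<Rightarrow> nat list \<Rightarrow>
   'v :: linorder set list \<Rightarrow> ('v \<Rightarrow> int) \<Rightarrow> nat \<Rightarrow> 'v set list timed pmf" where
  "reduction_loop F rc k\<^sub>0 bs Ss I c =
     (case max_index Ss I of ((m, xs), t) \<Rightarrow>
        if m > int k\<^sub>0 + 1 then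
          bind_pmf (pmf_of_set (set xs)) (\<lambda>x.
            case try_remove F rc k\<^sub>0 bs Ss I x of ((Ss', I'), u) \<Rightarrow>
              reduction_loop F rc k\<^sub>0 bs Ss' I' (c + t + 2 + u))
        else return_pmf (Ss, c + t + 1))"
  by auto
termination
proof (relation "Wellfounded.measure (\<lambda>(F, rc, k\<^sub>0, bs, Ss, I, c). card {y. {y} \<in> set Ss \<and> I y \<noteq> - 1})",
    goal_cases)
  case 1
  then show ?case by simp
next
  case (2 F rc k\<^sub>0 bs Ss I c p t m xs x q u Ss' I')
  then have *: "max_index Ss I = ((m, xs), t)" "m > - 1"
    by auto
  with 2 have "x \<in> set xs"
    using max_index_attained(1) by (metis List.finite_set set_empty set_pmf_of_set)
  from max_index_attained(2)[OF * this] * have "{x} \<in> set Ss" "I x \<noteq> - 1"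
    by auto
  moreover have "try_remove F rc k\<^sub>0 bs Ss I x = ((Ss', I'), u)"
    using 2 by simp
  ultimately show ?case
    by (auto dest: try_remove_decreases)
qed

declare reduction_loop.simps [simp del]

definition reduction ::
  "'f :: field itself \<Rightarrow> (nat \<Rightarrow> nat \<Rightarrow> nat) \<Rightarrow> nat \<Rightarrow>
   'v :: linorder set list \<Rightarrow> 'v list \<Rightarrow> 'v set list timed pmf" where
  "reduction F rc k\<^sub>0 Ss L =
     (let (bs, t1) = compute_bettis F rc k\<^sub>0 Ss;
          (I, t2) = update_indices k\<^sub>0 Ss (\<lambda>_. 0);
          (I', t3) = timed_fold (\<lambda>x J. (J(x := - 1), 1)) L I
      in reduction_loop F rc k\<^sub>0 bs Ss I' (t1 + t2 + t3))"

text \<open>Operation counts of all runs on a given complex: the input may list the simplices in any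
  order, and any vertices may be critical.\<close>

definition reduction_costs ::
  "'f :: field itself \<Rightarrow> (nat \<Rightarrow> nat \<Rightarrow> nat) \<Rightarrow> nat \<Rightarrow> 'v :: linorder set set \<Rightarrow> nat set" where
  "reduction_costs F rc k\<^sub>0 S =
     {c. \<exists>Ss L Ss'. distinct Ss \<and> set Ss = S \<and> distinct L \<and> (\<forall>x \<in> set L. {x} \<in> S) \<and>
           (Ss', c) \<in> set_pmf (reduction F rc k\<^sub>0 Ss L)}"

text \<open>Operation counts of all runs on the Vietoris-Rips complexes of a random configuration \<open>X\<close>.\<close>

definition rips_reduction_costs ::
  "'f :: field itself \<Rightarrow> (nat \<Rightarrow> nat \<Rightarrow> nat) \<Rightarrow> nat \<Rightarrow> 'w measure \<Rightarrow> real \<Rightarrow> real \<Rightarrow> nat \<Rightarrow>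
   (nat \<Rightarrow> 'w \<Rightarrow> real ^ 'd) \<Rightarrow> nat set" where
  "rips_reduction_costs F rc k\<^sub>0 M a r n X =
     (\<Union>\<omega> \<in> space M. reduction_costs F rc k\<^sub>0 (vietoris_rips a r n (\<lambda>i. X i \<omega>)))"

end

theory Submission
  imports Defs "HOL-Real_Asymp.Real_Asymp"
begin

text \<open>On \<open>n\<close> vertices a complex has at most \<open>2\<^sup>n\<close> simplices, and \<open>O(n\<^bsup>k+1\<^esup>)\<close> of dimension \<open>k\<close>. The
  boundary matrices in dimensions up to \<open>k\<^sub>0 + 1\<close> thus have polynomial size, so that the Betti numbers
  cost \<open>O(2\<^sup>n)\<close>, the polynomial being absorbed and only the traversals of the list of simplices
  remaining. The dominant part of a round of the loop is the computation of the degrees, which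
  compares each of the \<open>O(n\<^bsup>k\<^sub>0+2\<^esup>)\<close> simplices of dimension \<open>k\<^sub>0 + 1\<close> with all simplices; there are
  at most \<open>n\<close> rounds.\<close>

section \<open>Costs of list traversals and absorption of polynomials\<close>

text \<open>The bound \<open>B\<close> is uniform in the accumulator because each step of the
  induction changes it. The initial 1 pays for reaching the end of the list, the 1 added to
  \<open>B\<close> for traversing an element.\<close>

lemma timed_fold_cost_le:
  assumes "\<And>x a. x \<in> set xs \<Longrightarrow> snd (f x a) \<le> B"
  shows "snd (timed_fold f xs a) \<le> 1 + length xs * (1 + B)"
  using assms
proof (induction xs arbitrary: a)
  case (Cons x xs)
  from Cons.prems[of x a] Cons.IH[of "fst (f x a)"] Cons.prems show ?case
    by (fastforce simp: split_beta Let_def)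
qed simp

lemma timed_map_cost_le:
  assumes "\<And>x. x \<in> set xs \<Longrightarrow> snd (f x) \<le> B"
  shows "snd (timed_map f xs) \<le> 1 + length xs * (1 + B)"
  using assms
proof (induction xs)
  case (Cons x xs)
  from Cons.prems[of x] Cons.IH Cons.prems show ?case
    by (fastforce simp: split_beta Let_def)
qed simp

lemma timed_filter_cost: "snd (timed_filter P xs) = 1 + 2 * length xs"
  by (induction xs) (simp_all add: split_beta Let_def)

text \<open>The quotient tends to 0, hence is bounded over all \<open>n\<close>, not only
  eventually. This gives constants valid for every \<open>n\<close>, rounded up to naturals since
  costs are naturals.\<close>

lemma pow_le_exp_bound: "\<exists>C. \<forall>n. (n + 1) ^ k \<le> C * (2 :: nat) ^ n"
proof -
  have "(\<lambda>n. (real n + 1) ^ k / 2 ^ n) \<longlonglongrightarrow> 0"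
    by real_asymp
  then have "Bseq (\<lambda>n. (real n + 1) ^ k / 2 ^ n)"
    by (intro convergent_imp_Bseq) (auto simp: convergent_def)
  then obtain D where D: "\<And>n. norm ((real n + 1) ^ k / 2 ^ n) \<le> D"
    unfolding Bseq_def by blast
  have "(n + 1) ^ k \<le> nat \<lceil>D\<rceil> * 2 ^ n" for n
  proof -
    have "(real n + 1) ^ k \<le> D * 2 ^ n"
      using D[of n] by (simp add: field_simps)
    also have "\<dots> \<le> real (nat \<lceil>D\<rceil>) * 2 ^ n"
      by (intro mult_right_mono real_nat_ceiling_ge) auto
    finally have "real ((n + 1) ^ k) \<le> real (nat \<lceil>D\<rceil> * 2 ^ n)"
      by (simp add: add.commute)
    then show ?thesis
      by (simp only: of_nat_le_iff)
  qed
  then show ?thesis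
    by blast
qed

section \<open>Counting simplices on at most n vertices\<close>

text \<open>Keeps only what counting requires, so that it is stable under every filter. With
  \<open>n\<close> as an upper bound instead of the exact number of vertices, it is an invariant of
  the loop for a fixed \<open>n\<close>.\<close>

definition simplex_list :: "nat \<Rightarrow> 'v set list \<Rightarrow> bool" where
  "simplex_list n Ss \<longleftrightarrow> distinct Ss \<and> (\<exists>V. finite V \<and> card V \<le> n \<and> set Ss \<subseteq> Pow V)"

lemma simplex_list_filter: "simplex_list n Ss \<Longrightarrow> simplex_list n (filter P Ss)"
  unfolding simplex_list_def by auto

lemma simplex_list_length:
  assumes "simplex_list n Ss"
  shows "length Ss \<le> 2 ^ n"
proof -
  obtain V where V: "finite V" "card V \<le> n" "set Ss \<subseteq> Pow V" and "distinct Ss"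
    using assms by (auto simp: simplex_list_def)
  then have "length Ss = card (set Ss)"
    by (simp add: distinct_card)
  also have "\<dots> \<le> card (Pow V)"
    using V by (intro card_mono) auto
  also have "\<dots> \<le> 2 ^ n"
    using V by (simp add: card_Pow)
  finally show ?thesis .
qed

text \<open>Here \<open>k\<close> counts vertices, so the dimension is \<open>k - 1\<close>. The
  base \<open>n + 1\<close> is positive even for \<open>n = 0\<close>, which makes the bound
  monotone in the exponent.\<close>

lemma simplex_list_level_length:
  assumes "simplex_list n Ss"
  shows "length (filter (\<lambda>\<sigma>. card \<sigma> = k) Ss) \<le> (n + 1) ^ k"
proof -
  obtain V where V: "finite V" "card V \<le> n" "set Ss \<subseteq> Pow V" and "distinct Ss"
    using assms by (auto simp: simplex_list_def)
  then have "length (filter (\<lambda>\<sigma>. card \<sigma> = k) Ss) = card (set (filter (\<lambda>\<sigma>. card \<sigma> = k) Ss))"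
    by (simp add: distinct_card del: set_filter)
  also have "\<dots> \<le> card {\<sigma>. \<sigma> \<subseteq> V \<and> card \<sigma> = k}"
    using V by (intro card_mono) auto
  also have "\<dots> = card V choose k"
    using V by (simp add: n_subsets)
  also have "\<dots> \<le> card V ^ k"
    by (cases "k \<le> card V") (auto simp: binomial_le_pow binomial_eq_0)
  also have "\<dots> \<le> (n + 1) ^ k"
    using V by (intro power_mono) auto
  finally show ?thesis .
qed

text \<open>This linear bound controls the number of rounds. The bound \<open>2 ^ n\<close> that
  suffices for a single traversal would square the exponential there.\<close>

lemma simplex_list_vertices:
  assumes "simplex_list n Ss"
  shows "finite {y. {y} \<in> set Ss}" and "card {y. {y} \<in> set Ss} \<le> n"
proof -
  obtain V where V: "finite V" "card V \<le> n" "{y. {y} \<in> set Ss} \<subseteq> V"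
    using assms by (fastforce simp: simplex_list_def)
  then show "finite {y. {y} \<in> set Ss}"
    by (blast intro: finite_subset)
  have "card {y. {y} \<in> set Ss} \<le> card V"
    using V by (intro card_mono) auto
  with V show "card {y. {y} \<in> set Ss} \<le> n"
    by simp
qed

section \<open>Cost of ranks and Betti numbers\<close>

lemma boundary_rank_cost_le:
  fixes Ss :: "'v :: linorder set list"
  defines "p \<equiv> \<lambda>k. length (filter (\<lambda>\<sigma>. card \<sigma> = k) Ss)"
  shows "snd (boundary_rank TYPE('f :: field) rc k Ss) \<le>
    4 * length Ss + 3 + p (k + 1) * (2 + p k * (k + 4)) + rc (p k) (p (k + 1))"
proof -
  let ?Rs = "filter (\<lambda>\<sigma>. card \<sigma> = k) Ss" and ?Cs = "filter (\<lambda>\<sigma>. card \<sigma> = k + 1) Ss"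
  have "snd (boundary_column ?Rs \<sigma> :: ('v set \<Rightarrow> 'f) timed) \<le> 1 + p k * (k + 4)"
    if "\<sigma> \<in> set ?Cs" for \<sigma>
    \<comment> \<open>An entry costs \<open>2 + card \<sigma>\<close>, which is \<open>k + 3\<close>
      for a column of dimension \<open>k\<close>; traversal of the row index makes it
      \<open>k + 4\<close>.\<close>
    unfolding boundary_column_def
    by (rule order_trans[OF timed_fold_cost_le[where B = "k + 3"]]) (use that in \<open>auto simp: p_def\<close>)
  then have "snd (timed_map (boundary_column ?Rs :: _ \<Rightarrow> ('v set \<Rightarrow> 'f) timed) ?Cs) \<le>
      1 + length ?Cs * (1 + (1 + p k * (k + 4)))"
    by (rule timed_map_cost_le)
  then show ?thesis
    by (simp add: boundary_rank_def split_beta Let_def timed_filter_cost p_def)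
qed

lemma boundary_rank_cost_exp:
  assumes rc: "\<And>p q. rc p q \<le> K * (p * q * min p q + 1)"
  shows "\<exists>A. \<forall>n k (Ss :: 'v :: linorder set list). k \<le> m \<longrightarrow> simplex_list n Ss \<longrightarrow>
    snd (boundary_rank TYPE('f :: field) rc k Ss) \<le> A * 2 ^ n"
proof -
  \<comment> \<open>The largest power comes from the rank: with \<open>min p q\<close> at most
    \<open>p\<close>, the product \<open>p * q * min p q\<close> has degree
    \<open>k + (k + 1) + k\<close>, at most \<open>3 * m + 1\<close>.\<close>
  obtain C where C: "\<And>n. (n + 1) ^ (3 * m + 1) \<le> C * (2 :: nat) ^ n"
    using pow_le_exp_bound by blast
  \<comment> \<open>Collects the coefficients of \<open>P\<close> below: \<open>m + 4\<close> from
    filling the matrix, 2 from traversing the columns, \<open>2 * K\<close> from the rank.\<close>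
  define D where "D = m + 6 + 2 * K"
  have "snd (boundary_rank TYPE('f :: field) rc k Ss) \<le> (7 + D * C) * 2 ^ n"
    if k: "k \<le> m" and Ss: "simplex_list n Ss" for n k and Ss :: "'v set list"
  proof -
    define p where "p = length (filter (\<lambda>\<sigma>. card \<sigma> = k) Ss)"
    define q where "q = length (filter (\<lambda>\<sigma>. card \<sigma> = k + 1) Ss)"
    define P where "P = (n + 1) ^ (3 * m + 1)"
    have p: "p \<le> (n + 1) ^ k" and q: "q \<le> (n + 1) ^ (k + 1)"
      unfolding p_def q_def using Ss by (rule simplex_list_level_length)+
    have pow: "(n + 1) ^ j \<le> P" if "j \<le> 3 * m + 1" for j
      unfolding P_def using that by (intro power_increasing) auto
    have qP: "q \<le> P"
      using q pow[of "k + 1"] k by linarith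
    have "q * p \<le> (n + 1) ^ (k + 1) * (n + 1) ^ k"
      using p q by (rule mult_le_mono[rotated])
    also have "\<dots> = (n + 1) ^ (2 * k + 1)"
      by (simp only: power_add[symmetric]) (simp add: mult_2)
    also have "\<dots> \<le> P"
      using k by (intro pow) auto
    finally have qpP: "q * p \<le> P" .
    have "p * q * min p q \<le> (n + 1) ^ k * (n + 1) ^ (k + 1) * (n + 1) ^ k"
      using p q by (intro mult_le_mono) auto
    also have "\<dots> = (n + 1) ^ (k + (k + 1) + k)"
      by (simp only: power_add)
    also have "\<dots> \<le> P"
      using k by (intro pow) auto
    finally have pqP: "p * q * min p q + 1 \<le> 2 * P"
      using pow[of 0] by simp
    have "snd (boundary_rank TYPE('f :: field) rc k Ss) \<le>
        4 * length Ss + 3 + q * (2 + p * (k + 4)) + rc p q"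
      using boundary_rank_cost_le[of rc k Ss, where ?'f = 'f] by (simp add: p_def q_def)
    also have "q * (2 + p * (k + 4)) = 2 * q + (k + 4) * (q * p)"
      by (simp add: algebra_simps)
    \<comment> \<open>From here on each step replaces one summand of the running bound by
      monotonicity.\<close>
    also have "rc p q \<le> K * (2 * P)"
      using rc[of p q] mult_le_mono2[OF pqP, of K] by linarith
    also have "2 * q \<le> 2 * P"
      using qP by simp
    also have "(k + 4) * (q * p) \<le> (m + 4) * P"
      using k qpP by (intro mult_le_mono) auto
    also have "length Ss \<le> 2 ^ n"
      using Ss by (rule simplex_list_length)
    also have "4 * 2 ^ n + 3 + (2 * P + (m + 4) * P) + K * (2 * P) = 4 * 2 ^ n + 3 + D * P"
      by (simp add: D_def algebra_simps)
    also have "D * P \<le> D * (C * 2 ^ n)"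
      using C[of n] by (simp add: P_def)
    also have "(3 :: nat) \<le> 3 * 2 ^ n"
      by simp
    also have "4 * 2 ^ n + 3 * 2 ^ n + D * (C * 2 ^ n) = (7 + D * C) * 2 ^ n"
      by (simp add: algebra_simps)
    finally show ?thesis
      by simp
  qed
  then show ?thesis
    by blast
qed

lemma compute_bettis_cost_exp:
  assumes rc: "\<And>p q. rc p q \<le> K * (p * q * min p q + 1)"
  shows "\<exists>A. \<forall>n (Ss :: 'v :: linorder set list). simplex_list n Ss \<longrightarrow>
    snd (compute_bettis TYPE('f :: field) rc k\<^sub>0 Ss) \<le> A * 2 ^ n"
proof -
  \<comment> \<open>The Betti number in dimension \<open>k\<close> involves the ranks in dimensions
    \<open>k\<close> and \<open>k + 1\<close>, so the range extends to
    \<open>k\<^sub>0 + 1\<close>.\<close>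
  obtain A where A: "\<And>n k (Ss :: 'v set list). k \<le> k\<^sub>0 + 1 \<Longrightarrow> simplex_list n Ss \<Longrightarrow>
      snd (boundary_rank TYPE('f) rc k Ss) \<le> A * 2 ^ n"
    using boundary_rank_cost_exp[OF rc] by metis
  define B where "B = 8 + 2 * A"
  have "snd (compute_bettis TYPE('f) rc k\<^sub>0 Ss) \<le> (1 + (k\<^sub>0 + 1) * (1 + B)) * 2 ^ n"
    if Ss: "simplex_list n Ss" for n and Ss :: "'v set list"
  proof -
    have "snd (compute_betti TYPE('f) rc Ss k) \<le> B * 2 ^ n" if "k \<in> set [0..<k\<^sub>0 + 1]" for k
    proof -
      let ?Cs = "filter (\<lambda>\<sigma>. card \<sigma> = k + 1) Ss"
      have k: "k \<le> k\<^sub>0 + 1" "k + 1 \<le> k\<^sub>0 + 1"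
        using that by auto
      have "snd (timed_fold (\<lambda>_ m. (m + 1, 1)) ?Cs (0 :: nat)) \<le> 1 + length ?Cs * (1 + 1)"
        by (rule timed_fold_cost_le) simp
      also have "\<dots> \<le> 1 + length Ss * (1 + 1)"
        by (intro add_left_mono mult_le_mono1 length_filter_le)
      finally have "snd (compute_betti TYPE('f) rc Ss k) \<le> 4 * length Ss + 4 +
          snd (boundary_rank TYPE('f) rc k Ss) + snd (boundary_rank TYPE('f) rc (k + 1) Ss)"
        by (simp add: compute_betti_def split_beta Let_def timed_filter_cost)
      also have "\<dots> \<le> 4 * 2 ^ n + 4 * 2 ^ n + A * 2 ^ n + A * 2 ^ n"
        by (intro add_mono A Ss k mult_le_mono2 simplex_list_length) simp
      also have "\<dots> = B * 2 ^ n"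
        by (simp add: B_def algebra_simps)
      finally show ?thesis .
    qed
    then have "snd (compute_bettis TYPE('f) rc k\<^sub>0 Ss) \<le> 1 + length [0..<k\<^sub>0 + 1] * (1 + B * 2 ^ n)"
      unfolding compute_bettis_def by (rule timed_map_cost_le)
    also have "\<dots> \<le> 2 ^ n + (k\<^sub>0 + 1) * (2 ^ n + B * 2 ^ n)"
      by (intro add_mono mult_le_mono) auto
    also have "\<dots> = (1 + (k\<^sub>0 + 1) * (1 + B)) * 2 ^ n"
      by (simp add: algebra_simps)
    finally show ?thesis .
  qed
  then show ?thesis
    by blast
qed

section \<open>Cost of degrees, indices and their maximum\<close>

text \<open>Source of the dominant term: a full scan of the complex for each simplex with
  \<open>k + 2\<close> vertices. The length of the resulting table is recorded because every index
  computation scans it.\<close>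

lemma compute_degrees_cost_le:
  assumes "simplex_list n Ss"
  shows "snd (compute_degrees k Ss) \<le> 11 * ((n + 1) ^ (k + 2) * 2 ^ n)"
    and "length (fst (compute_degrees k Ss)) \<le> (n + 1) ^ (k + 2)"
proof -
  let ?\<Sigma>s = "filter (\<lambda>\<sigma>. card \<sigma> = k + 2) Ss"
  let ?E = "2 ^ n :: nat" and ?N = "(n + 1) ^ (k + 2)"
  have Ss: "length Ss \<le> ?E" and \<Sigma>s: "length ?\<Sigma>s \<le> ?N"
    using assms by (rule simplex_list_length simplex_list_level_length)+
  have one: "1 \<le> ?E"
    by simp
  show "length (fst (compute_degrees k Ss)) \<le> ?N"
    using \<Sigma>s by (simp add: compute_degrees_def split_beta Let_def)
  have "snd (compute_degree Ss \<sigma>) \<le> 1 + length Ss * (1 + 3)" for \<sigma>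
    unfolding compute_degree_def by (rule timed_fold_cost_le) simp
  \<comment> \<open>The last 1 is the writing of the degree into the table.\<close>
  moreover have "1 + length Ss * (1 + 3) + 1 \<le> 6 * ?E"
    using Ss one unfolding distrib_left by linarith
  ultimately have "snd (compute_degree Ss \<sigma>) + 1 \<le> 6 * ?E" for \<sigma>
    by (meson add_le_mono1 order_trans)
  then have "snd (timed_map (\<lambda>\<sigma>. let (d, v) = compute_degree Ss \<sigma> in ((\<sigma>, d), v + 1)) ?\<Sigma>s) \<le>
      1 + length ?\<Sigma>s * (1 + 6 * ?E)"
    by (intro timed_map_cost_le) (simp add: split_beta)
  also have "\<dots> \<le> 1 + ?N * (?E + 6 * ?E)"
    using \<Sigma>s by (intro add_mono mult_le_mono) auto
  finally have "snd (compute_degrees k Ss) \<le> 2 * ?E + 2 + 7 * (?N * ?E)"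
    using Ss by (simp add: compute_degrees_def split_beta Let_def timed_filter_cost del: power_Suc)
  moreover have "?E \<le> ?N * ?E" and "1 \<le> ?N * ?E"
    by (simp_all del: power_Suc)
  ultimately show "snd (compute_degrees k Ss) \<le> 11 * (?N * ?E)"
    by linarith
qed

lemma list_vertices_cost_le:
  assumes "simplex_list n Ss"
  shows "snd (list_vertices Ss) \<le> 6 * 2 ^ n"
    and "length (fst (list_vertices Ss)) \<le> 2 ^ n"
proof -
  let ?Vs = "filter (\<lambda>\<sigma>. card \<sigma> = 1) Ss"
  have Ss: "length Ss \<le> 2 ^ n"
    using assms by (rule simplex_list_length)
  have "length ?Vs \<le> length Ss"
    by simp
  with Ss have "length ?Vs \<le> 2 ^ n"
    by (rule order_trans[rotated])
  then show "length (fst (list_vertices Ss)) \<le> 2 ^ n"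
    by (simp add: list_vertices_def split_beta Let_def)
  have "snd (timed_map (\<lambda>\<sigma>. (the_elem \<sigma>, 1)) ?Vs) \<le> 1 + length ?Vs * (1 + 1)"
    by (rule timed_map_cost_le) simp
  then have "snd (list_vertices Ss) \<le> 2 + 2 * length Ss + 2 * length ?Vs"
    by (simp add: list_vertices_def split_beta Let_def timed_filter_cost)
  moreover have "length ?Vs \<le> length Ss" and "(1 :: nat) \<le> 2 ^ n"
    by simp_all
  ultimately show "snd (list_vertices Ss) \<le> 6 * 2 ^ n"
    using Ss by linarith
qed

text \<open>An index scans a table of length at most \<open>N\<close>. Even with the crude bound
  \<open>E\<close> on the number of vertices, all indices together cost \<open>O(N * E)\<close>, the
  same order as the degrees.\<close>

lemma update_indices_cost_le:
  assumes "simplex_list n Ss"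
  shows "snd (update_indices k Ss I) \<le> 28 * ((n + 1) ^ (k + 2) * 2 ^ n)"
proof -
  define ds where "ds = fst (compute_degrees k Ss)"
  define xs where "xs = fst (list_vertices Ss)"
  define N E where "N = (n + 1) ^ (k + 2)" and "E = (2 :: nat) ^ n"
  have ds: "length ds \<le> N"
    unfolding ds_def N_def using assms by (rule compute_degrees_cost_le)
  have xs: "length xs \<le> E"
    unfolding xs_def E_def using assms by (rule list_vertices_cost_le)
  have N: "1 \<le> N" and E: "1 \<le> E"
    unfolding N_def E_def by (intro one_le_power; simp)+
  have "snd (compute_index ds x) \<le> 1 + length ds * (1 + 3) + 1" for x
    unfolding compute_index_def Let_def split_beta snd_conv
    by (intro add_mono timed_fold_cost_le order_refl) (simp add: split_beta)
  moreover have "1 + length ds * (1 + 3) + 1 + 3 \<le> 9 * N"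
    using ds N unfolding distrib_left by linarith
  ultimately have idx: "snd (compute_index ds x) + 3 \<le> 9 * N" for x
    by (meson add_le_mono1 order_trans)
  have "snd (timed_fold (\<lambda>x J. if J x = - 1 then (J, 2)
      else let (i, t) = compute_index ds x in (J(x := int i), t + 3)) xs I) \<le> 1 + length xs * (1 + 9 * N)"
    \<comment> \<open>A skipped vertex costs 2, which is below \<open>9 * N\<close> because
      \<open>N\<close> is at least 1.\<close>
    using idx N by (intro timed_fold_cost_le) (auto simp: split_beta Let_def)
  also have "\<dots> \<le> 1 + E * (N + 9 * N)"
    using xs N by (intro add_mono mult_le_mono) auto
  also have "\<dots> = 1 + 10 * (N * E)"
    by simp
  finally have "snd (update_indices k Ss I) \<le> 11 * (N * E) + 6 * E + (1 + 10 * (N * E))"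
    using compute_degrees_cost_le(1)[OF assms, of k] list_vertices_cost_le(1)[OF assms]
    unfolding update_indices_def Let_def split_beta snd_conv ds_def xs_def N_def E_def
    by (intro add_mono)
  moreover have "E \<le> N * E" "1 \<le> N * E"
    using N E by simp_all
  ultimately show ?thesis
    unfolding N_def[symmetric] E_def[symmetric] by linarith
qed

lemma max_index_cost_le:
  assumes "simplex_list n Ss"
  shows "snd (max_index Ss I) \<le> 13 * 2 ^ n"
proof -
  define xs where "xs = fst (list_vertices Ss)"
  have xs: "length xs \<le> 2 ^ n"
    unfolding xs_def using assms by (rule list_vertices_cost_le)
  have "snd (timed_fold (\<lambda>x m. (max m (I x), 2)) xs (- 1)) \<le> 1 + length xs * (1 + 2)"
    by (rule timed_fold_cost_le) simp
  then have "snd (max_index Ss I) \<le> snd (list_vertices Ss) + 5 * length xs + 2"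
    by (simp add: max_index_def split_beta Let_def timed_filter_cost xs_def)
  moreover have "(1 :: nat) \<le> 2 ^ n"
    by simp
  ultimately show ?thesis
    using xs list_vertices_cost_le(1)[OF assms] by linarith
qed

section \<open>Cost of a round and of a whole run\<close>

lemma try_remove_simplices:
  assumes "try_remove F rc k\<^sub>0 bs Ss I x = ((Ss', I'), t)" and "simplex_list n Ss"
  shows "simplex_list n Ss'"
  using assms simplex_list_filter[OF assms(2)]
  by (auto simp: try_remove_def split_beta Let_def split: if_splits)

text \<open>The last bracket adds up the final costs of both branches, 1 for a cancelled removal and
  the update for an accepted one, so a single bound covers either outcome.\<close>

lemma try_remove_cost_le:
  assumes "simplex_list n Ss"
  shows "snd (try_remove F rc k\<^sub>0 bs Ss I x) \<le> 1 + 2 * length Ss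
    + snd (compute_bettis F rc k\<^sub>0 (filter (\<lambda>\<tau>. \<not> {x} \<subseteq> \<tau>) Ss)) + length bs
    + (1 + 28 * ((n + 1) ^ (k\<^sub>0 + 2) * 2 ^ n))"
  using update_indices_cost_le[OF simplex_list_filter[OF assms], of k\<^sub>0 "\<lambda>\<tau>. \<not> {x} \<subseteq> \<tau>" I]
  by (auto simp: try_remove_def split_beta Let_def timed_filter_cost simp del: power_Suc)

text \<open>Every round removes a vertex or fixes its index to \<open>-1\<close>, so the number of vertices with
  another index bounds the number of rounds.\<close>

lemma reduction_loop_cost_le:
  fixes Ss :: "'v :: linorder set list"
  assumes max: "\<And>(Ss :: 'v set list) I. simplex_list n Ss \<Longrightarrow> snd (max_index Ss I) \<le> B"
    and remove: "\<And>(Ss :: 'v set list) I x. simplex_list n Ss \<Longrightarrow> snd (try_remove F rc k\<^sub>0 bs Ss I x) \<le> B"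
    and "simplex_list n Ss" and "(Ss', c') \<in> set_pmf (reduction_loop F rc k\<^sub>0 bs Ss I c)"
  shows "c' \<le> c + (card {y. {y} \<in> set Ss \<and> I y \<noteq> - 1} + 1) * (2 * B + 2)"
  using assms(3,4)
proof (induction "card {y. {y} \<in> set Ss \<and> I y \<noteq> - 1}" arbitrary: Ss I c rule: less_induct)
  case less
  obtain m xs t where mi: "max_index Ss I = ((m, xs), t)"
    by (metis prod.exhaust)
  have t: "t \<le> B"
    using max[OF less.prems(1), of I] mi by simp
  show ?case
  proof (cases "m > int k\<^sub>0 + 1")
    case False
    \<comment> \<open>The final evaluation of the loop condition is paid for by the 1 added to the
      number of remaining vertices.\<close>
    with less.prems(2) mi have "c' = c + t + 1"
      by (subst (asm) reduction_loop.simps) simp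
    with t show ?thesis
      by simp
  next
    case True
    then have m: "m > - 1"
      by simp
    \<comment> \<open>A maximum above -1 is attained, so the uniform distribution is over a nonempty
      set and its support consists of the attaining vertices.\<close>
    have xs: "set_pmf (pmf_of_set (set xs)) = set xs"
      using max_index_attained(1)[OF mi m] by simp
    from less.prems(2) mi True xs obtain x where x: "x \<in> set xs"
      and c': "(Ss', c') \<in> set_pmf (case try_remove F rc k\<^sub>0 bs Ss I x of ((Ss', I'), u) \<Rightarrow>
        reduction_loop F rc k\<^sub>0 bs Ss' I' (c + t + 2 + u))"
      by (subst (asm) reduction_loop.simps) auto
    obtain Ss1 I1 u where tr: "try_remove F rc k\<^sub>0 bs Ss I x = ((Ss1, I1), u)"
      by (metis prod.exhaust)
    have u: "u \<le> B"
      using remove[OF less.prems(1), of I x] tr by simp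
    have "{x} \<in> set Ss" "I x \<noteq> - 1"
      using max_index_attained(2)[OF mi m x] m by auto
    note dec = try_remove_decreases[OF this tr]
    let ?w = "card {y. {y} \<in> set Ss \<and> I y \<noteq> - 1}" and ?w1 = "card {y. {y} \<in> set Ss1 \<and> I1 y \<noteq> - 1}"
    have "c' \<le> c + t + 2 + u + (?w1 + 1) * (2 * B + 2)"
      using c' unfolding tr prod.case by (rule less.hyps[OF dec try_remove_simplices[OF tr less.prems(1)]])
    also have "\<dots> \<le> c + (2 * B + 2) + (?w1 + 1) * (2 * B + 2)"
      using t u by simp
    also have "\<dots> = c + (Suc ?w1 + 1) * (2 * B + 2)"
      by simp
    also have "\<dots> \<le> c + (?w + 1) * (2 * B + 2)"
      using dec by (intro add_mono mult_le_mono) auto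
    finally show ?thesis .
  qed
qed

lemma reduction_cost_exp:
  assumes rc: "\<And>p q. rc p q \<le> K * (p * q * min p q + 1)"
  shows "\<exists>A. \<forall>n (Ss :: 'v :: linorder set list) L Ss' c.
    simplex_list n Ss \<longrightarrow> distinct L \<longrightarrow> (\<forall>x \<in> set L. {x} \<in> set Ss) \<longrightarrow>
    (Ss', c) \<in> set_pmf (reduction TYPE('f :: field) rc k\<^sub>0 Ss L) \<longrightarrow>
    c \<le> A * ((n + 1) ^ (k\<^sub>0 + 3) * 2 ^ n)"
proof -
  obtain A where A: "\<And>n (Ss :: 'v set list). simplex_list n Ss \<Longrightarrow>
      snd (compute_bettis TYPE('f) rc k\<^sub>0 Ss) \<le> A * 2 ^ n"
    using compute_bettis_cost_exp[OF rc] by metis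
  \<comment> \<open>Coefficient of \<open>U\<close> in the cost of a round: \<open>A\<close> for the
    Betti numbers, \<open>k\<^sub>0 + 1\<close> for comparing them, \<open>1 + 2\<close> for the
    filter and \<open>1 + 28\<close> for the two branches.\<close>
  define D where "D = A + k\<^sub>0 + 33"
  have "c \<le> (A + 31 + (2 * D + 2)) * ((n + 1) ^ (k\<^sub>0 + 3) * 2 ^ n)"
    if Ss: "simplex_list n Ss" and L: "distinct L" "\<forall>x \<in> set L. {x} \<in> set Ss"
      and c: "(Ss', c) \<in> set_pmf (reduction TYPE('f) rc k\<^sub>0 Ss L)"
    for n and Ss :: "'v set list" and L Ss' c
  proof -
    define E U where "E = (2 :: nat) ^ n" and "U = (n + 1) ^ (k\<^sub>0 + 2) * E"
    have E: "1 \<le> E" "n \<le> E"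
      using less_exp[of n] by (simp_all add: E_def)
    have EU: "E \<le> U"
      unfolding U_def by (simp del: power_Suc add_2_eq_Suc')
    have AE: "A * E \<le> A * U"
      using EU by simp
    define bs where "bs = fst (compute_bettis TYPE('f) rc k\<^sub>0 Ss)"
    define J where "J = fst (timed_fold (\<lambda>x J. (J(x := - 1), 1)) L (fst (update_indices k\<^sub>0 Ss (\<lambda>_. 0))))"
    define b where "b = snd (compute_bettis TYPE('f) rc k\<^sub>0 Ss)"
    define i where "i = snd (update_indices k\<^sub>0 Ss (\<lambda>_. 0))"
    define l where "l = snd (timed_fold (\<lambda>x J. (J(x := - 1), 1)) L (fst (update_indices k\<^sub>0 Ss (\<lambda>_. 0))))"
    have b: "b \<le> A * E"
      unfolding b_def E_def using Ss by (rule A)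
    have i: "i \<le> 28 * U"
      unfolding i_def U_def E_def using Ss by (rule update_indices_cost_le)
    have "length L = card (set L)"
      using L(1) by (simp add: distinct_card)
    also have "\<dots> \<le> card {y. {y} \<in> set Ss}"
      using L(2) by (intro card_mono simplex_list_vertices(1)[OF Ss]) auto
    also have "\<dots> \<le> n"
      using Ss by (rule simplex_list_vertices)
    finally have "length L \<le> n" .
    moreover have "l \<le> 1 + length L * (1 + 1)"
      unfolding l_def by (rule timed_fold_cost_le) simp
    ultimately have l: "l \<le> 3 * U"
      using E EU unfolding distrib_left by linarith
    have bs: "length bs = k\<^sub>0 + 1"
      by (simp add: bs_def compute_bettis_def)
    have max: "snd (max_index Ss I) \<le> D * U" if "simplex_list n Ss" for Ss :: "'v set list" and I
    proof -
      have "13 * U \<le> D * U"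
        by (intro mult_le_mono) (auto simp: D_def)
      then show ?thesis
        using max_index_cost_le[OF that, of I] EU unfolding E_def by linarith
    qed
    have remove: "snd (try_remove TYPE('f) rc k\<^sub>0 bs Ss I x) \<le> D * U"
      if Ss: "simplex_list n Ss" for Ss :: "'v set list" and I x
    proof -
      have "k\<^sub>0 * 1 \<le> k\<^sub>0 * U"
        using E EU by (intro mult_le_mono2) linarith
      then have "A * U + k\<^sub>0 + 33 * U \<le> D * U"
        by (simp add: D_def algebra_simps)
      moreover have "length Ss \<le> E"
        unfolding E_def using Ss by (rule simplex_list_length)
      moreover have "snd (compute_bettis TYPE('f) rc k\<^sub>0 (filter (\<lambda>\<tau>. \<not> {x} \<subseteq> \<tau>) Ss)) \<le> A * E"
        unfolding E_def using Ss by (intro A simplex_list_filter)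
      ultimately show ?thesis
        using try_remove_cost_le[OF Ss, of "TYPE('f)" rc k\<^sub>0 bs I x] bs E EU AE
        unfolding U_def[symmetric] E_def[symmetric] by linarith
    qed
    have loop: "(Ss', c) \<in> set_pmf (reduction_loop TYPE('f) rc k\<^sub>0 bs Ss J (b + i + l))"
      using c by (simp add: reduction_def split_beta Let_def bs_def J_def b_def i_def l_def)
    have w: "card {y. {y} \<in> set Ss \<and> J y \<noteq> - 1} \<le> card {y. {y} \<in> set Ss}"
      by (intro card_mono simplex_list_vertices(1)[OF Ss]) auto
    have "c \<le> b + i + l + (card {y. {y} \<in> set Ss \<and> J y \<noteq> - 1} + 1) * (2 * (D * U) + 2)"
      by (rule reduction_loop_cost_le[OF _ _ Ss loop]) (intro max remove; assumption)+
    \<comment> \<open>The set-up costs \<open>A\<close> for the Betti numbers, 28 for the indices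
      and 3 for marking the critical vertices, in units of \<open>U\<close>. The factor
      \<open>n + 1\<close> from the rounds raises the exponent from \<open>k\<^sub>0 + 2\<close> to
      \<open>k\<^sub>0 + 3\<close>.\<close>
    also have "\<dots> \<le> (A + 31) * U + (n + 1) * (2 * (D * U) + 2 * U)"
    proof (intro add_mono mult_le_mono order_refl)
      show "b + i + l \<le> (A + 31) * U"
        using b i l AE unfolding distrib_right by linarith
      show "card {y. {y} \<in> set Ss \<and> J y \<noteq> - 1} \<le> n"
        using w simplex_list_vertices(2)[OF Ss] by (rule order_trans)
      show "2 \<le> 2 * U"
        using E EU by simp
    qed
    also have "\<dots> \<le> (A + 31) * ((n + 1) * U) + (n + 1) * (2 * (D * U) + 2 * U)"
      by simp
    also have "\<dots> = (A + 31 + (2 * D + 2)) * ((n + 1) * U)"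
      by (simp add: algebra_simps)
    also have "(n + 1) * U = (n + 1) ^ (k\<^sub>0 + 3) * 2 ^ n"
      by (simp add: U_def E_def power_add power3_eq_cube power2_eq_square algebra_simps)
    finally show ?thesis .
  qed
  then show ?thesis
    by blast
qed

section \<open>Vietoris-Rips complexes\<close>

lemma vietoris_rips_simplex_list:
  assumes "distinct Ss" and "set Ss = vietoris_rips a r n P"
  shows "simplex_list n Ss"
proof -
  have "set Ss \<subseteq> Pow {..<n}"
    by (auto simp: assms(2) vietoris_rips_def)
  with assms(1) show ?thesis
    unfolding simplex_list_def by (intro conjI exI[of _ "{..<n}"]) auto
qed

text \<open>The constant is chosen before \<open>n\<close>, the probability space and the point
  configuration. This uniformity bounds the supremum over all outcomes and makes the estimate
  asymptotic in \<open>n\<close>.\<close>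

lemma rips_reduction_costs_exp:
  assumes "\<And>p q. rc p q \<le> K * (p * q * min p q + 1)"
  shows "\<exists>A. \<forall>(M :: 'w measure) a r n (X :: nat \<Rightarrow> 'w \<Rightarrow> real ^ 'd).
    \<forall>c \<in> rips_reduction_costs TYPE('f :: field) rc k\<^sub>0 M a r n X.
      c \<le> A * ((n + 1) ^ (k\<^sub>0 + 3) * 2 ^ n)"
proof -
  obtain A where A: "\<And>n (Ss :: nat set list) L Ss' c. simplex_list n Ss \<Longrightarrow> distinct L \<Longrightarrow>
      \<forall>x \<in> set L. {x} \<in> set Ss \<Longrightarrow> (Ss', c) \<in> set_pmf (reduction TYPE('f) rc k\<^sub>0 Ss L) \<Longrightarrow>
      c \<le> A * ((n + 1) ^ (k\<^sub>0 + 3) * 2 ^ n)"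
    using reduction_cost_exp[OF assms] by metis
  show ?thesis
  proof (intro exI[of _ A] allI ballI)
    fix M :: "'w measure" and a r n and X :: "nat \<Rightarrow> 'w \<Rightarrow> real ^ 'd" and c
    assume "c \<in> rips_reduction_costs TYPE('f) rc k\<^sub>0 M a r n X"
    then obtain \<omega> Ss L Ss' where "distinct Ss" "set Ss = vietoris_rips a r n (\<lambda>i. X i \<omega>)"
      and "distinct L" "\<forall>x \<in> set L. {x} \<in> set Ss" "(Ss', c) \<in> set_pmf (reduction TYPE('f) rc k\<^sub>0 Ss L)"
      unfolding rips_reduction_costs_def reduction_costs_def by blast
    then show "c \<le> A * ((n + 1) ^ (k\<^sub>0 + 3) * 2 ^ n)"
      by (intro A vietoris_rips_simplex_list)
  qed
qed

theorem theorem16: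
  fixes k\<^sub>0 :: nat
    and a r :: "nat \<Rightarrow> real"
    and M :: "nat \<Rightarrow> 'w measure"
    and X :: "nat \<Rightarrow> nat \<Rightarrow> 'w \<Rightarrow> real ^ 'd"
    and rank_cost :: "nat \<Rightarrow> nat \<Rightarrow> nat"
  assumes "\<And>n. a n > 0" and "\<And>n. r n \<ge> 0"
    and "\<And>n. (r n / a n) ^ CARD('d) \<le> (1 / 2) ^ CARD('d)"
    and "(\<lambda>n. 1 / real n) \<in> o(\<lambda>n. (r n / a n) ^ CARD('d))"
    and "\<And>n. binomial_process (M n) (a n) n (X n)"
    and "\<exists>K. \<forall>p q. rank_cost p q \<le> K * (p * q * min p q + 1)"
  shows "(\<forall>n. bdd_above (rips_reduction_costs TYPE('f :: field) rank_cost k\<^sub>0 (M n) (a n) (r n) n (X n))) \<and>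
         (\<lambda>n. real (Sup (rips_reduction_costs TYPE('f) rank_cost k\<^sub>0 (M n) (a n) (r n) n (X n))))
           \<in> O(\<lambda>n. real n ^ (k\<^sub>0 + 3) * 2 ^ n)"
proof -
  let ?C = "\<lambda>n. rips_reduction_costs TYPE('f) rank_cost k\<^sub>0 (M n) (a n) (r n) n (X n)"
  obtain K where "\<And>p q. rank_cost p q \<le> K * (p * q * min p q + 1)"
    using assms(6) by blast
  from rips_reduction_costs_exp[OF this, where ?'w = 'w and ?'d = 'd and ?'f = 'f]
  obtain A where A: "\<And>n c. c \<in> ?C n \<Longrightarrow> c \<le> A * ((n + 1) ^ (k\<^sub>0 + 3) * 2 ^ n)"
    by metis
  \<comment> \<open>covers the empty set of costs too, \<open>Sup {}\<close> being \<open>0\<close> in the naturals\<close>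
  have Sup: "Sup (?C n) \<le> A * ((n + 1) ^ (k\<^sub>0 + 3) * 2 ^ n)" for n
    using A cSup_least[of "?C n"] by (cases "?C n = {}") (auto simp: Sup_nat_empty simp del: power_Suc)
  \<comment> \<open>For \<open>n\<close> at least 1, \<open>n + 1\<close> is at most
    \<open>2 * n\<close>, which costs the factor \<open>2 ^ (k\<^sub>0 + 3)\<close>. At
    \<open>n = 0\<close> the right-hand side vanishes.\<close>
  have "norm (real (Sup (?C n))) \<le> (real A * 2 ^ (k\<^sub>0 + 3)) * norm (real n ^ (k\<^sub>0 + 3) * 2 ^ n)"
    if "n \<ge> 1" for n
  proof -
    have "(n + 1) ^ (k\<^sub>0 + 3) \<le> (2 * n) ^ (k\<^sub>0 + 3)"
      using that by (intro power_mono) auto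
    then have "A * ((n + 1) ^ (k\<^sub>0 + 3) * 2 ^ n) \<le> A * ((2 * n) ^ (k\<^sub>0 + 3) * 2 ^ n)"
      by (intro mult_le_mono order_refl)
    with Sup[of n] have "real (Sup (?C n)) \<le> real (A * ((2 * n) ^ (k\<^sub>0 + 3) * 2 ^ n))"
      by (simp only: of_nat_le_iff order_trans)
    then show ?thesis
      by (simp add: power_mult_distrib mult_ac del: power_Suc)
  qed
  then have "(\<lambda>n. real (Sup (?C n))) \<in> O(\<lambda>n. real n ^ (k\<^sub>0 + 3) * 2 ^ n)"
    by (intro bigoI eventually_sequentiallyI)
  moreover have "bdd_above (?C n)" for n
    using A by (rule bdd_aboveI)
  ultimately show ?thesis
    by blast
qed

end
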